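(* Let $(M,\varphi,\xi,\eta,g)$ be a 3-dimensional $\mathcal{F}_4$-manifold and let $C(t)$ be a non-geodesic $\varphi$-slant null curve in $M$ with constants $a=\eta(\dot C)$, $b=g(\dot C,\varphi\dot C)$. Then, among the general Frenet frames along $C$ having the same orientation as $\{\dot C,\xi,\varphi\dot C\}$, there exists a unique Frenet frame $\mathbf{F}_1=\{\dot C,N_1,W_1\}$ for which the original parameter $t$ of $C(t)$ is distinguished, and the vector fields $W_1,N_1$ are given by $$W_1=-\frac{b}{\sqrt{a^4+b^2}}\,\xi+\frac{a}{\sqrt{a^4+b^2}}\,\varphi\dot C,$$ $$N_1=\frac{a^3}{a^4+b^2}\,\xi-\frac{a^2}{2(a^4+b^2)}\,\dot C+\frac{b}{a^4+b^2}\,\varphi\dot C.$$ The curvature function $k_2$ with respect to $\mathbf{F}_1$ is $$k_2=\frac{a^2\,\theta(\xi)}{4\sqrt{a^4+b^2}}.$$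
   Context: A 3-dimensional almost contact B-metric manifold $(M,\varphi,\xi,\eta,g)$ is a smooth 3-manifold with a $(1,1)$-tensor field $\varphi$, a vector field $\xi$, a 1-form $\eta$ and a semi-Riemannian metric $g$ such that $\varphi^2X=-X+\eta(X)\xi$, $\eta(\xi)=1$, and $g(\varphi X,\varphi Y)=-g(X,Y)+\eta(X)\eta(Y)$. Consequently $\eta\circ\varphi=0$, $\varphi\xi=0$, $\eta(X)=g(X,\xi)$, $g(\xi,\xi)=1$, and $g$ has signature $(2,1)$. Let $\nabla$ be the Levi-Civita connection of $g$, $F(X,Y,Z)=g((\nabla_X\varphi)Y,Z)$, and $\theta(X)=g^{ij}F(e_i,e_j,X)$ for a local basis $\{e_i\}$, where $(g^{ij})$ is the inverse of $(g(e_i,e_j))$. $M$ is an $\mathcal{F}_4$-manifold if $$F(X,Y,Z)=-\tfrac{\theta(\xi)}{2}\{g(\varphi X,\varphi Y)\eta(Z)+g(\varphi X,\varphi Z)\eta(Y)\};$$ then $\nabla_X\xi=\tfrac{\theta(\xi)}{2}\varphi X$. Here $\theta(\xi)$ is a smooth function on $M$, evaluated along $C$. A smooth curve $C(t)$ is null if $g(\dot C,\dot C)=0$ and $\dot C\ne0$ everywhere. It is $\varphi$-slant if $\eta(\dot C)=a$ and $g(\dot C,\varphi\dot C)=b$ with $a,b$ real constants. For a $\varphi$-slant null curve in dimension 3 one has $(a,b)\neq(0,0)$, and $\{\dot C,\xi,\varphi\dot C\}$ is a basis of the tangent space at each point of $C$. A general Frenet frame along a null curve $C$ is a frame $\{\dot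 C,N,W\}$ of vector fields along $C$ with $g(\dot C,N)=g(W,W)=1$, $g(N,N)=g(N,W)=g(\dot C,W)=0$. The general Frenet equations are $$\nabla_{\dot C}\dot C=h\dot C+k_1W,\quad \nabla_{\dot C}N=-hN+k_2W,\quad \nabla_{\dot C}W=-k_2\dot C-k_1N,$$ with functions $h,k_1,k_2$ along $C$. The parameter $t$ is distinguished with respect to a frame if $h=0$ identically for that frame. A null curve is geodesic iff $k_1$ vanishes identically; "non-geodesic" means that $k_1$ is nowhere zero along $C$ (this does not depend on the choice of frame). *)

theory Defs
  imports "HOL-Analysis.Analysis"
begin

section \<open>Smooth maps between open subsets of normed spaces\<close>

(* On an open set of a finite-dimensional space this is the usual C^k condition: in the
   successor step all directional derivatives are required to be C^k. *)
fun Ck_on :: "nat \<Rightarrow> 'v::real_normed_vector set \<Rightarrow> ('v \<Rightarrow> 'w::real_normed_vector) \<Rightarrow> bool" where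
  "Ck_on 0 S f \<longleftrightarrow> continuous_on S f"
| "Ck_on (Suc k) S f \<longleftrightarrow>
     (\<forall>x\<in>S. f differentiable (at x)) \<and>
     (\<forall>v. Ck_on k S (\<lambda>x. frechet_derivative f (at x) v))"

definition smooth_on :: "'v::real_normed_vector set \<Rightarrow> ('v \<Rightarrow> 'w::real_normed_vector) \<Rightarrow> bool" where
  "smooth_on S f \<longleftrightarrow> (\<forall>k. Ck_on k S f)"


section \<open>Smooth 3-manifolds\<close>

(* A chart is a pair (domain, coordinate map); the coordinate map is irrelevant off its domain. *)
type_synonym 'a chart = "'a set \<times> ('a \<Rightarrow> real^3)"

definition chart_inv :: "'a chart \<Rightarrow> real^3 \<Rightarrow> 'a" where
  "chart_inv c = inv_into (fst c) (snd c)"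

definition transition :: "'a chart \<Rightarrow> 'a chart \<Rightarrow> real^3 \<Rightarrow> real^3" where
  "transition c c' = snd c' \<circ> chart_inv c"

definition chart_on :: "'a topology \<Rightarrow> 'a chart \<Rightarrow> bool" where
  "chart_on X c \<longleftrightarrow>
     openin X (fst c) \<and> open (snd c ` fst c) \<and>
     homeomorphic_map (subtopology X (fst c)) (top_of_set (snd c ` fst c)) (snd c)"

definition smooth_manifold :: "'a topology \<Rightarrow> 'a chart set \<Rightarrow> bool" where
  "smooth_manifold X A \<longleftrightarrow>
     Hausdorff_space X \<and> second_countable X \<and>
     (\<forall>c\<in>A. chart_on X c) \<and> (\<Union>c\<in>A. fst c) = topspace X \<and>
     (\<forall>c\<in>A. \<forall>c'\<in>A. smooth_on (snd c ` (fst c \<inter> fst c')) (transition c c'))"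

(* Some chart of the atlas around p; used below only in expressions whose value does not
   depend on the choice. *)
definition chart_at :: "'a chart set \<Rightarrow> 'a \<Rightarrow> 'a chart" where
  "chart_at A p = (SOME c. c \<in> A \<and> p \<in> fst c)"


section \<open>Tangent vectors\<close>

(* A tangent vector at p is the family of its coordinate columns with respect to all charts of
   the atlas around p, related by the Jacobians of the transition maps (see tangent_space).
   The type below is the ambient real vector space of all families. *)
typedef 'a tangent = "UNIV :: ('a chart \<Rightarrow> real^3) set"
  morphisms comp Tangent
  by simp

setup_lifting type_definition_tangent

instantiation tangent :: (type) real_vector
begin

lift_definition zero_tangent :: "'a tangent" is "\<lambda>c. 0" .
lift_definition plus_tangent :: "'a tangent \<Rightarrow> 'a tangent \<Rightarrow> 'a tangent" is "\<lambda>v w c. v c + w c" .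
lift_definition minus_tangent :: "'a tangent \<Rightarrow> 'a tangent \<Rightarrow> 'a tangent" is "\<lambda>v w c. v c - w c" .
lift_definition uminus_tangent :: "'a tangent \<Rightarrow> 'a tangent" is "\<lambda>v c. - v c" .
lift_definition scaleR_tangent :: "real \<Rightarrow> 'a tangent \<Rightarrow> 'a tangent" is "\<lambda>r v c. r *\<^sub>R v c" .

instance
  by (standard; transfer) (auto simp: algebra_simps fun_eq_iff)

end

definition tangent_space :: "'a chart set \<Rightarrow> 'a \<Rightarrow> 'a tangent set" where
  "tangent_space A p =
     {v. (\<forall>c\<in>A. \<forall>c'\<in>A. p \<in> fst c \<inter> fst c' \<longrightarrow>
            comp v c' = frechet_derivative (transition c c') (at (snd c p)) (comp v c)) \<and>
         (\<forall>c. \<not> (c \<in> A \<and> p \<in> fst c) \<longrightarrow> comp v c = 0)}"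

(* The coordinate vector field of the chart c in direction i. *)
definition coord_field :: "'a chart set \<Rightarrow> 'a chart \<Rightarrow> 3 \<Rightarrow> 'a \<Rightarrow> 'a tangent" where
  "coord_field A c i p =
     Tangent (\<lambda>c'. if c' \<in> A \<and> p \<in> fst c \<inter> fst c'
                   then frechet_derivative (transition c c') (at (snd c p)) (axis i 1) else 0)"

(* The derivative v(f) of a function f in the direction of the tangent vector v at p. *)
definition dir_deriv :: "'a chart set \<Rightarrow> 'a \<Rightarrow> 'a tangent \<Rightarrow> ('a \<Rightarrow> real) \<Rightarrow> real" where
  "dir_deriv A p v f =
     (let c = chart_at A p in frechet_derivative (f \<circ> chart_inv c) (at (snd c p)) (comp v c))"


section \<open>Smooth functions, vector fields and tensor fields\<close>

definition smooth_function :: "'a topology \<Rightarrow> 'a chart set \<Rightarrow> 'a set \<Rightarrow> ('a \<Rightarrow> real) \<Rightarrow> bool" where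
  "smooth_function X A U f \<longleftrightarrow>
     openin X U \<and> (\<forall>c\<in>A. smooth_on (snd c ` (U \<inter> fst c)) (f \<circ> chart_inv c))"

definition smooth_vector_field ::
    "'a topology \<Rightarrow> 'a chart set \<Rightarrow> 'a set \<Rightarrow> ('a \<Rightarrow> 'a tangent) \<Rightarrow> bool" where
  "smooth_vector_field X A U Y \<longleftrightarrow>
     openin X U \<and> (\<forall>p\<in>U. Y p \<in> tangent_space A p) \<and>
     (\<forall>c\<in>A. smooth_on (snd c ` (U \<inter> fst c)) (\<lambda>x. comp (Y (chart_inv c x)) c))"

(* Pointwise linear maps on the tangent spaces; smoothness of a tensor field means that it maps
   smooth (local) vector fields to smooth (local) functions, respectively vector fields. *)
definition smooth_one_form ::
    "'a topology \<Rightarrow> 'a chart set \<Rightarrow> ('a \<Rightarrow> 'a tangent \<Rightarrow> real) \<Rightarrow> bool" where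
  "smooth_one_form X A \<eta> \<longleftrightarrow>
     (\<forall>p\<in>topspace X. \<forall>v\<in>tangent_space A p. \<forall>w\<in>tangent_space A p. \<forall>r s.
        \<eta> p (r *\<^sub>R v + s *\<^sub>R w) = r * \<eta> p v + s * \<eta> p w) \<and>
     (\<forall>U Y. smooth_vector_field X A U Y \<longrightarrow> smooth_function X A U (\<lambda>p. \<eta> p (Y p)))"

definition smooth_endomorphism_field ::
    "'a topology \<Rightarrow> 'a chart set \<Rightarrow> ('a \<Rightarrow> 'a tangent \<Rightarrow> 'a tangent) \<Rightarrow> bool" where
  "smooth_endomorphism_field X A \<phi> \<longleftrightarrow>
     (\<forall>p\<in>topspace X. \<forall>v\<in>tangent_space A p. \<phi> p v \<in> tangent_space A p) \<and>
     (\<forall>p\<in>topspace X. \<forall>v\<in>tangent_space A p. \<forall>w\<in>tangent_space A p. \<forall>r s.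
        \<phi> p (r *\<^sub>R v + s *\<^sub>R w) = r *\<^sub>R \<phi> p v + s *\<^sub>R \<phi> p w) \<and>
     (\<forall>U Y. smooth_vector_field X A U Y \<longrightarrow> smooth_vector_field X A U (\<lambda>p. \<phi> p (Y p)))"

(* No condition on the index of g: the B-metric condition forces signature (2,1). *)
definition semi_riemannian_metric ::
    "'a topology \<Rightarrow> 'a chart set \<Rightarrow> ('a \<Rightarrow> 'a tangent \<Rightarrow> 'a tangent \<Rightarrow> real) \<Rightarrow> bool" where
  "semi_riemannian_metric X A g \<longleftrightarrow>
     (\<forall>p\<in>topspace X. \<forall>u\<in>tangent_space A p. \<forall>v\<in>tangent_space A p. \<forall>w\<in>tangent_space A p. \<forall>r s.
        g p (r *\<^sub>R v + s *\<^sub>R w) u = r * g p v u + s * g p w u) \<and>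
     (\<forall>p\<in>topspace X. \<forall>v\<in>tangent_space A p. \<forall>w\<in>tangent_space A p. g p v w = g p w v) \<and>
     (\<forall>p\<in>topspace X. \<forall>v\<in>tangent_space A p. (\<forall>w\<in>tangent_space A p. g p v w = 0) \<longrightarrow> v = 0) \<and>
     (\<forall>U Y Z. smooth_vector_field X A U Y \<and> smooth_vector_field X A U Z \<longrightarrow>
        smooth_function X A U (\<lambda>p. g p (Y p) (Z p)))"


section \<open>The Levi-Civita connection\<close>

(* "nabla p v Y" is the covariant derivative at p, in the direction v, of a vector field Y
   that is smooth on some open neighbourhood of p. *)
type_synonym 'a conn = "'a \<Rightarrow> 'a tangent \<Rightarrow> ('a \<Rightarrow> 'a tangent) \<Rightarrow> 'a tangent"

definition affine_connection :: "'a topology \<Rightarrow> 'a chart set \<Rightarrow> 'a conn \<Rightarrow> bool" where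
  "affine_connection X A nabla \<longleftrightarrow>
     (\<forall>U Y. smooth_vector_field X A U Y \<longrightarrow>
        (\<forall>p\<in>U. \<forall>v\<in>tangent_space A p.
           nabla p v Y \<in> tangent_space A p \<and>
           (\<forall>w\<in>tangent_space A p. \<forall>r s.
              nabla p (r *\<^sub>R v + s *\<^sub>R w) Y = r *\<^sub>R nabla p v Y + s *\<^sub>R nabla p w Y) \<and>
           (\<forall>Z. smooth_vector_field X A U Z \<longrightarrow>
              nabla p v (\<lambda>q. Y q + Z q) = nabla p v Y + nabla p v Z) \<and>
           (\<forall>Z. smooth_vector_field X A U Z \<and> (\<forall>q\<in>U. Z q = Y q) \<longrightarrow>
              nabla p v Z = nabla p v Y) \<and>
           (\<forall>f. smooth_function X A U f \<longrightarrow>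
              nabla p v (\<lambda>q. f q *\<^sub>R Y q) = dir_deriv A p v f *\<^sub>R Y p + f p *\<^sub>R nabla p v Y)) \<and>
        (\<forall>Z. smooth_vector_field X A U Z \<longrightarrow>
           smooth_vector_field X A U (\<lambda>p. nabla p (Z p) Y)))"

definition lie_bracket ::
    "'a chart set \<Rightarrow> ('a \<Rightarrow> 'a tangent) \<Rightarrow> ('a \<Rightarrow> 'a tangent) \<Rightarrow> 'a \<Rightarrow> 'a tangent" where
  "lie_bracket A Y Z p =
     Tangent (\<lambda>c. if c \<in> A \<and> p \<in> fst c
       then frechet_derivative (\<lambda>x. comp (Z (chart_inv c x)) c) (at (snd c p)) (comp (Y p) c)
          - frechet_derivative (\<lambda>x. comp (Y (chart_inv c x)) c) (at (snd c p)) (comp (Z p) c)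
       else 0)"

definition levi_civita ::
    "'a topology \<Rightarrow> 'a chart set \<Rightarrow> ('a \<Rightarrow> 'a tangent \<Rightarrow> 'a tangent \<Rightarrow> real) \<Rightarrow> 'a conn \<Rightarrow> bool" where
  "levi_civita X A g nabla \<longleftrightarrow>
     affine_connection X A nabla \<and>
     (\<forall>U Y Z. smooth_vector_field X A U Y \<and> smooth_vector_field X A U Z \<longrightarrow>
        (\<forall>p\<in>U. nabla p (Y p) Z - nabla p (Z p) Y = lie_bracket A Y Z p \<and>
           (\<forall>v\<in>tangent_space A p.
              dir_deriv A p v (\<lambda>q. g q (Y q) (Z q)) =
                g p (nabla p v Y) (Z p) + g p (Y p) (nabla p v Z))))"


section \<open>Almost contact B-metric manifolds of class F4\<close>

definition almost_contact_B_metric_manifold ::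
    "'a topology \<Rightarrow> 'a chart set \<Rightarrow> ('a \<Rightarrow> 'a tangent \<Rightarrow> 'a tangent) \<Rightarrow> ('a \<Rightarrow> 'a tangent) \<Rightarrow>
     ('a \<Rightarrow> 'a tangent \<Rightarrow> real) \<Rightarrow> ('a \<Rightarrow> 'a tangent \<Rightarrow> 'a tangent \<Rightarrow> real) \<Rightarrow> bool" where
  "almost_contact_B_metric_manifold X A \<phi> \<xi> \<eta> g \<longleftrightarrow>
     smooth_manifold X A \<and>
     smooth_endomorphism_field X A \<phi> \<and> smooth_vector_field X A (topspace X) \<xi> \<and>
     smooth_one_form X A \<eta> \<and> semi_riemannian_metric X A g \<and>
     (\<forall>p\<in>topspace X.
        \<eta> p (\<xi> p) = 1 \<and>
        (\<forall>v\<in>tangent_space A p. \<phi> p (\<phi> p v) = - v + \<eta> p v *\<^sub>R \<xi> p) \<and>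
        (\<forall>v\<in>tangent_space A p. \<forall>w\<in>tangent_space A p.
           g p (\<phi> p v) (\<phi> p w) = - g p v w + \<eta> p v * \<eta> p w))"

definition fundamental_F ::
    "('a \<Rightarrow> 'a tangent \<Rightarrow> 'a tangent) \<Rightarrow> ('a \<Rightarrow> 'a tangent \<Rightarrow> 'a tangent \<Rightarrow> real) \<Rightarrow> 'a conn \<Rightarrow>
     ('a \<Rightarrow> 'a tangent) \<Rightarrow> ('a \<Rightarrow> 'a tangent) \<Rightarrow> ('a \<Rightarrow> 'a tangent) \<Rightarrow> 'a \<Rightarrow> real" where
  "fundamental_F \<phi> g nabla V Y Z p =
     g p (nabla p (V p) (\<lambda>q. \<phi> q (Y q)) - \<phi> p (nabla p (V p) Y)) (Z p)"

definition local_frame ::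
    "'a topology \<Rightarrow> 'a chart set \<Rightarrow> 'a set \<Rightarrow> (3 \<Rightarrow> 'a \<Rightarrow> 'a tangent) \<Rightarrow> bool" where
  "local_frame X A U e \<longleftrightarrow>
     (\<forall>i. smooth_vector_field X A U (e i)) \<and>
     (\<forall>p\<in>U. inj (\<lambda>i. e i p) \<and> independent (range (\<lambda>i. e i p)) \<and>
        span (range (\<lambda>i. e i p)) = tangent_space A p)"

(* The common value, over all local frames e around p, of g^ij F(e_i, e_j, Z) at p. *)
definition lee_form ::
    "'a topology \<Rightarrow> 'a chart set \<Rightarrow> ('a \<Rightarrow> 'a tangent \<Rightarrow> 'a tangent) \<Rightarrow>
     ('a \<Rightarrow> 'a tangent \<Rightarrow> 'a tangent \<Rightarrow> real) \<Rightarrow> 'a conn \<Rightarrow> ('a \<Rightarrow> 'a tangent) \<Rightarrow> 'a \<Rightarrow> real" where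
  "lee_form X A \<phi> g nabla Z p =
     (THE r. \<forall>U e. p \<in> U \<and> local_frame X A U e \<longrightarrow>
        r = (\<Sum>i\<in>UNIV. \<Sum>j\<in>UNIV.
               matrix_inv ((\<chi> k l. g p (e k p) (e l p)) :: real^3^3) $ i $ j *
               fundamental_F \<phi> g nabla (e i) (e j) Z p))"

definition F4_manifold ::
    "'a topology \<Rightarrow> 'a chart set \<Rightarrow> ('a \<Rightarrow> 'a tangent \<Rightarrow> 'a tangent) \<Rightarrow> ('a \<Rightarrow> 'a tangent) \<Rightarrow>
     ('a \<Rightarrow> 'a tangent \<Rightarrow> real) \<Rightarrow> ('a \<Rightarrow> 'a tangent \<Rightarrow> 'a tangent \<Rightarrow> real) \<Rightarrow> 'a conn \<Rightarrow> bool" where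
  "F4_manifold X A \<phi> \<xi> \<eta> g nabla \<longleftrightarrow>
     almost_contact_B_metric_manifold X A \<phi> \<xi> \<eta> g \<and> levi_civita X A g nabla \<and>
     (\<forall>U V Y Z. smooth_vector_field X A U V \<and> smooth_vector_field X A U Y \<and>
                smooth_vector_field X A U Z \<longrightarrow>
        (\<forall>p\<in>U. fundamental_F \<phi> g nabla V Y Z p =
           - (lee_form X A \<phi> g nabla \<xi> p / 2) *
             (g p (\<phi> p (V p)) (\<phi> p (Y p)) * \<eta> p (Z p) +
              g p (\<phi> p (V p)) (\<phi> p (Z p)) * \<eta> p (Y p))))"


section \<open>Curves and Frenet frames\<close>

definition smooth_curve :: "'a topology \<Rightarrow> 'a chart set \<Rightarrow> real set \<Rightarrow> (real \<Rightarrow> 'a) \<Rightarrow> bool" where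
  "smooth_curve X A I C \<longleftrightarrow>
     I \<noteq> {} \<and> open I \<and> is_interval I \<and> continuous_map (top_of_set I) X C \<and>
     (\<forall>c\<in>A. smooth_on {t\<in>I. C t \<in> fst c} (snd c \<circ> C))"

definition velocity :: "'a chart set \<Rightarrow> (real \<Rightarrow> 'a) \<Rightarrow> real \<Rightarrow> 'a tangent" where
  "velocity A C t =
     Tangent (\<lambda>c. if c \<in> A \<and> C t \<in> fst c then vector_derivative (snd c \<circ> C) (at t) else 0)"

definition smooth_field_along ::
    "'a chart set \<Rightarrow> real set \<Rightarrow> (real \<Rightarrow> 'a) \<Rightarrow> (real \<Rightarrow> 'a tangent) \<Rightarrow> bool" where
  "smooth_field_along A I C V \<longleftrightarrow>
     (\<forall>t\<in>I. V t \<in> tangent_space A (C t)) \<and>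
     (\<forall>c\<in>A. smooth_on {t\<in>I. C t \<in> fst c} (\<lambda>t. comp (V t) c))"

(* Covariant derivative along C: if V = sum_i V^i d_i in a chart around C(t), then it is
   sum_i (dV^i/dt) d_i + V^i nabla_{C'} d_i. *)
definition cov_deriv_along ::
    "'a chart set \<Rightarrow> 'a conn \<Rightarrow> (real \<Rightarrow> 'a) \<Rightarrow> (real \<Rightarrow> 'a tangent) \<Rightarrow> real \<Rightarrow> 'a tangent" where
  "cov_deriv_along A nabla C V t =
     (let c = chart_at A (C t) in
        \<Sum>i\<in>UNIV.
          vector_derivative (\<lambda>s. comp (V s) c $ i) (at t) *\<^sub>R coord_field A c i (C t) +
          comp (V t) c $ i *\<^sub>R nabla (C t) (velocity A C t) (coord_field A c i))"

definition null_curve ::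
    "'a chart set \<Rightarrow> ('a \<Rightarrow> 'a tangent \<Rightarrow> 'a tangent \<Rightarrow> real) \<Rightarrow> real set \<Rightarrow> (real \<Rightarrow> 'a) \<Rightarrow> bool" where
  "null_curve A g I C \<longleftrightarrow>
     (\<forall>t\<in>I. g (C t) (velocity A C t) (velocity A C t) = 0 \<and> velocity A C t \<noteq> 0)"

definition phi_slant ::
    "'a chart set \<Rightarrow> ('a \<Rightarrow> 'a tangent \<Rightarrow> 'a tangent) \<Rightarrow> ('a \<Rightarrow> 'a tangent \<Rightarrow> real) \<Rightarrow>
     ('a \<Rightarrow> 'a tangent \<Rightarrow> 'a tangent \<Rightarrow> real) \<Rightarrow> real set \<Rightarrow> (real \<Rightarrow> 'a) \<Rightarrow> real \<Rightarrow> real \<Rightarrow> bool" where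
  "phi_slant A \<phi> \<eta> g I C a b \<longleftrightarrow>
     (\<forall>t\<in>I. \<eta> (C t) (velocity A C t) = a \<and>
        g (C t) (velocity A C t) (\<phi> (C t) (velocity A C t)) = b)"

definition general_frenet_frame ::
    "'a chart set \<Rightarrow> ('a \<Rightarrow> 'a tangent \<Rightarrow> 'a tangent \<Rightarrow> real) \<Rightarrow> real set \<Rightarrow> (real \<Rightarrow> 'a) \<Rightarrow>
     (real \<Rightarrow> 'a tangent) \<Rightarrow> (real \<Rightarrow> 'a tangent) \<Rightarrow> bool" where
  "general_frenet_frame A g I C N W \<longleftrightarrow>
     smooth_field_along A I C N \<and> smooth_field_along A I C W \<and>
     (\<forall>t\<in>I. g (C t) (velocity A C t) (N t) = 1 \<and> g (C t) (W t) (W t) = 1 \<and>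
        g (C t) (N t) (N t) = 0 \<and> g (C t) (N t) (W t) = 0 \<and>
        g (C t) (velocity A C t) (W t) = 0)"

definition frenet_equations ::
    "'a chart set \<Rightarrow> 'a conn \<Rightarrow> real set \<Rightarrow> (real \<Rightarrow> 'a) \<Rightarrow>
     (real \<Rightarrow> 'a tangent) \<Rightarrow> (real \<Rightarrow> 'a tangent) \<Rightarrow>
     (real \<Rightarrow> real) \<Rightarrow> (real \<Rightarrow> real) \<Rightarrow> (real \<Rightarrow> real) \<Rightarrow> bool" where
  "frenet_equations A nabla I C N W h k1 k2 \<longleftrightarrow>
     (\<forall>t\<in>I.
        cov_deriv_along A nabla C (velocity A C) t = h t *\<^sub>R velocity A C t + k1 t *\<^sub>R W t \<and>
        cov_deriv_along A nabla C N t = - h t *\<^sub>R N t + k2 t *\<^sub>R W t \<and>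
        cov_deriv_along A nabla C W t = - k2 t *\<^sub>R velocity A C t - k1 t *\<^sub>R N t)"

(* For a given frame the functions h, k1, k2 exist and are uniquely determined on I. *)
definition distinguished_parameter ::
    "'a chart set \<Rightarrow> 'a conn \<Rightarrow> real set \<Rightarrow> (real \<Rightarrow> 'a) \<Rightarrow>
     (real \<Rightarrow> 'a tangent) \<Rightarrow> (real \<Rightarrow> 'a tangent) \<Rightarrow> bool" where
  "distinguished_parameter A nabla I C N W \<longleftrightarrow>
     (\<exists>h k1 k2. frenet_equations A nabla I C N W h k1 k2 \<and> (\<forall>t\<in>I. h t = 0))"

(* The condition does not depend on the frame. *)
definition non_geodesic ::
    "'a chart set \<Rightarrow> ('a \<Rightarrow> 'a tangent \<Rightarrow> 'a tangent \<Rightarrow> real) \<Rightarrow> 'a conn \<Rightarrow>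
     real set \<Rightarrow> (real \<Rightarrow> 'a) \<Rightarrow> bool" where
  "non_geodesic A g nabla I C \<longleftrightarrow>
     (\<exists>N W h k1 k2. general_frenet_frame A g I C N W \<and>
        frenet_equations A nabla I C N W h k1 k2 \<and> (\<forall>t\<in>I. k1 t \<noteq> 0))"

(* e and f are ordered bases of the same 3-dimensional space. *)
definition same_orientation :: "'v::real_vector^3 \<Rightarrow> 'v^3 \<Rightarrow> bool" where
  "same_orientation e f \<longleftrightarrow>
     (\<exists>P :: real^3^3. det P > 0 \<and> (\<forall>i. e $ i = (\<Sum>j\<in>UNIV. P $ i $ j *\<^sub>R f $ j)))"

end

theory Submission
  imports Defs
begin

text \<open>
  Along the curve, differentiating the constants \<open>g(T,T) = 0\<close>, \<open>g(T,\<xi>) = a\<close> and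
  \<open>g(T,\<phi>T) = b\<close> and inserting the \<open>F\<^sub>4\<close> identity yields the products of \<open>\<nabla>\<^sub>T T\<close> with the basis
  \<open>{T, \<xi>, \<phi>T}\<close>: they are \<open>0\<close>, \<open>-\<theta>(\<xi>) b/2\<close> and \<open>\<theta>(\<xi>) a\<^sup>3/2\<close>. Hence
  \<open>\<nabla>\<^sub>T T = (\<theta>(\<xi>) sqrt(a\<^sup>4 + b\<^sup>2)/2) W\<^sub>1\<close>, so \<open>h = 0\<close> for the frame \<open>(N\<^sub>1, W\<^sub>1)\<close>, and for a
  non-geodesic curve \<open>\<theta>(\<xi>)\<close> has no zeros. Any other frame with \<open>h = 0\<close> has its \<open>W\<close> proportional
  to \<open>\<nabla>\<^sub>T T\<close>, thus equal to \<open>W\<^sub>1\<close> up to a sign that the orientation determines.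
\<close>

section \<open>Calculus of smooth maps\<close>

text \<open>The main obstacle is that metric compatibility and the \<open>F4\<close> identity are
  stated for vector fields on open sets, whereas \<open>T\<close>, \<open>\<phi>T\<close>,
  \<open>N\<close>, \<open>W\<close> live only along \<open>C\<close>, and
  \<open>cov_deriv_along\<close> is a formula in one chosen chart. Expanding a field along
  \<open>C\<close> in coordinate fields bridges the gap: the time derivatives of the coefficients
  are handled by the product rule, and the remaining terms involve only genuine vector fields. On
  the curve everything then becomes polynomial algebra in \<open>a\<close> and \<open>b\<close>.
  Solving for the acceleration gives \<open>\<theta>(\<xi>)/2\<close> times
  \<open>-b \<xi> + a \<phi>T\<close>, a vector of squared length \<open>a^4 + b^2\<close>; this is
  the origin of the square root. Once the spacelike vector of the frame is known up to sign, the
  remaining null vector is forced, and it is the same for both signs. Orientation therefore has only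
  this one sign to decide.\<close>

lemma has_derivative_frechet:
  "f differentiable (at x) \<Longrightarrow> (f has_derivative frechet_derivative f (at x)) (at x)"
  by (simp add: frechet_derivative_works)

text \<open>Openness turns agreement on \<open>S\<close> into agreement near each point, so the
  derivatives agree as well and the induction can pass to them. Differentiability has to be
  transferred first, because \<open>frechet_derivative\<close> is meaningful only where a derivative
  exists.\<close>

lemma Ck_on_cong:
  assumes "open S" "\<And>x. x \<in> S \<Longrightarrow> f x = h x"
  shows "Ck_on k S f \<longleftrightarrow> Ck_on k S h"
  using assms(2)
proof (induction k arbitrary: f h)
  case 0
  then show ?case
    by (auto intro!: continuous_on_cong)
next
  case (Suc k)
  have diff: "f' differentiable (at x) \<Longrightarrow> h' differentiable (at x)"
    if "x \<in> S" "\<And>x. x \<in> S \<Longrightarrow> f' x = h' x" for f' h' :: "'a \<Rightarrow> 'b" and x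
    using that assms(1) unfolding differentiable_def
    by (meson has_derivative_transform_within_open)
  have D: "frechet_derivative f (at x) v = frechet_derivative h (at x) v"
    if "x \<in> S" "f differentiable (at x)" for x v
    using frechet_derivative_transform_within_open[of f x S h] that assms(1) Suc.prems by simp
  have "(\<forall>x\<in>S. f differentiable (at x)) \<longleftrightarrow> (\<forall>x\<in>S. h differentiable (at x))"
    using diff[of _ f h] diff[of _ h f] Suc.prems by metis
  moreover have "Ck_on k S (\<lambda>x. frechet_derivative f (at x) v)
      \<longleftrightarrow> Ck_on k S (\<lambda>x. frechet_derivative h (at x) v)"
    if "\<forall>x\<in>S. f differentiable (at x)" for v
    by (rule Suc.IH) (use D that in auto)
  ultimately show ?case
    by auto
qed

text \<open>Lets a derivative computed by the usual rules stand in for the chosen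
  \<open>frechet_derivative\<close>. The closure properties under linear maps, sums, products and
  composition are inductions on \<open>k\<close> through this rule.\<close>

lemma Ck_on_SucI:
  assumes "open S" and "\<And>x. x \<in> S \<Longrightarrow> (f has_derivative f' x) (at x)"
    and "\<And>v. Ck_on k S (\<lambda>x. f' x v)"
  shows "Ck_on (Suc k) S f"
proof -
  have "frechet_derivative f (at x) = f' x" if "x \<in> S" for x
    using frechet_derivative_at[OF assms(2)[OF that]] by simp
  then have "Ck_on k S (\<lambda>x. frechet_derivative f (at x) v)" for v
    by (subst Ck_on_cong[OF assms(1), of _ "\<lambda>x. f' x v"]) (simp_all add: assms(3))
  then show ?thesis
    using assms(2) by (auto simp: differentiable_def)
qed

text \<open>The product and chain rules leave undifferentiated factors in the derivative. These are
  known to be of class \<open>Suc k\<close>, but the induction hypothesis wants them at level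
  \<open>k\<close>.\<close>

lemma Ck_on_Suc_imp_Ck_on: "Ck_on (Suc k) S f \<Longrightarrow> Ck_on k S f"
proof (induction k arbitrary: f)
  case 0
  then show ?case
    by (auto intro!: continuous_at_imp_continuous_on differentiable_imp_continuous_within)
next
  case (Suc k)
  have "Ck_on (Suc k) S (\<lambda>x. frechet_derivative f (at x) v)" for v
    using Suc.prems by (subst (asm) Ck_on.simps(2)) blast
  then show ?case
    using Suc.IH Suc.prems by (subst Ck_on.simps(2)) simp
qed

lemma Ck_on_subset: "Ck_on k S f \<Longrightarrow> S' \<subseteq> S \<Longrightarrow> Ck_on k S' f"
  by (induction k arbitrary: f) (auto intro: continuous_on_subset)

lemma Ck_on_const: "open S \<Longrightarrow> Ck_on k S (\<lambda>x. c)"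
  by (induction k arbitrary: c) auto

lemma Ck_on_bounded_linear:
  assumes "bounded_linear L" "open S" "Ck_on k S f"
  shows "Ck_on k S (\<lambda>x. L (f x))"
  using assms(3)
proof (induction k arbitrary: f)
  case 0
  then show ?case
    using bounded_linear.continuous_on[OF assms(1)] by auto
next
  case (Suc k)
  show ?case
  proof (rule Ck_on_SucI[OF assms(2)])
    show "((\<lambda>x. L (f x)) has_derivative (\<lambda>v. L (frechet_derivative f (at x) v))) (at x)"
      if "x \<in> S" for x
      using Suc.prems that
      by (intro bounded_linear.has_derivative[OF assms(1)] has_derivative_frechet) auto
  qed (use Suc in auto)
qed

lemma Ck_on_add:
  assumes "open S" "Ck_on k S f" "Ck_on k S h"
  shows "Ck_on k S (\<lambda>x. f x + h x)"
  using assms(2,3)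
proof (induction k arbitrary: f h)
  case 0
  then show ?case
    by (auto intro: continuous_on_add)
next
  case (Suc k)
  show ?case
  proof (rule Ck_on_SucI[OF assms(1)])
    show "((\<lambda>x. f x + h x) has_derivative
        (\<lambda>v. frechet_derivative f (at x) v + frechet_derivative h (at x) v)) (at x)"
      if "x \<in> S" for x
      using Suc.prems that by (intro has_derivative_add has_derivative_frechet) auto
  qed (use Suc in auto)
qed

lemma Ck_on_sum:
  assumes "open S" "\<And>i. i \<in> J \<Longrightarrow> Ck_on k S (f i)"
  shows "Ck_on k S (\<lambda>x. \<Sum>i\<in>J. f i x)"
  using assms(2)
  by (induction J rule: infinite_finite_induct) (auto intro: Ck_on_const Ck_on_add assms(1))

lemma Ck_on_scaleR:
  assumes "open S" "Ck_on k S f" "Ck_on k S h"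
  shows "Ck_on k S (\<lambda>x. f x *\<^sub>R h x)"
  using assms(2,3)
proof (induction k arbitrary: f h)
  case 0
  then show ?case
    by (auto intro: continuous_on_scaleR)
next
  case (Suc k)
  show ?case
  proof (rule Ck_on_SucI[OF assms(1)])
    show "((\<lambda>x. f x *\<^sub>R h x) has_derivative
        (\<lambda>v. f x *\<^sub>R frechet_derivative h (at x) v + frechet_derivative f (at x) v *\<^sub>R h x)) (at x)"
      if "x \<in> S" for x
      using Suc.prems that by (intro has_derivative_scaleR has_derivative_frechet) auto
    show "Ck_on k S (\<lambda>x. f x *\<^sub>R frechet_derivative h (at x) v + frechet_derivative f (at x) v *\<^sub>R h x)" for v
      using Suc.prems Suc.prems[THEN Ck_on_Suc_imp_Ck_on]
      by (intro Ck_on_add[OF assms(1)] Suc.IH) auto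
  qed
qed

text \<open>In the chain rule the direction \<open>frechet_derivative h (at x) v\<close> moves with
  \<open>x\<close>, while \<open>Ck_on\<close> speaks only of derivatives in fixed directions.
  Expanding the moving direction in \<open>Basis\<close> gives finitely many fixed directions with
  scalar coefficients of class \<open>k\<close>.\<close>

lemma Ck_on_compose:
  fixes f :: "'v::euclidean_space \<Rightarrow> 'w::real_normed_vector"
    and h :: "'u::real_normed_vector \<Rightarrow> 'v"
  assumes "open S" "open S'" "h ` S \<subseteq> S'" "Ck_on k S h" "Ck_on k S' f"
  shows "Ck_on k S (\<lambda>x. f (h x))"
  using assms(4,5)
proof (induction k arbitrary: f)
  case 0
  then show ?case
    using continuous_on_compose2 assms(3) by (metis Ck_on.simps(1))
next
  case (Suc k)
  have dh: "h differentiable (at x)" and df: "f differentiable (at (h x))" if "x \<in> S" for x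
    using Suc.prems that assms(3) by auto
  have expand: "frechet_derivative f (at (h x)) (frechet_derivative h (at x) v) =
      (\<Sum>b\<in>Basis. (frechet_derivative h (at x) v \<bullet> b) *\<^sub>R frechet_derivative f (at (h x)) b)"
    if "x \<in> S" for x v
  proof -
    have "linear (frechet_derivative f (at (h x)))"
      using df[OF that] by (rule linear_frechet_derivative)
    then show ?thesis
      by (subst (1) euclidean_representation[symmetric]) (simp add: linear_sum linear_scale)
  qed
  show ?case
  proof (rule Ck_on_SucI[OF assms(1)])
    show "((\<lambda>x. f (h x)) has_derivative
        (\<lambda>v. frechet_derivative f (at (h x)) (frechet_derivative h (at x) v))) (at x)"
      if "x \<in> S" for x
      using diff_chain_at[OF has_derivative_frechet[OF dh] has_derivative_frechet[OF df]] that
      by (simp add: o_def)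
    show "Ck_on k S (\<lambda>x. frechet_derivative f (at (h x)) (frechet_derivative h (at x) v))" for v
    proof (subst Ck_on_cong[OF assms(1) expand], assumption)
      show "Ck_on k S (\<lambda>x. \<Sum>b\<in>Basis.
          (frechet_derivative h (at x) v \<bullet> b) *\<^sub>R frechet_derivative f (at (h x)) b)"
        using Suc.prems Ck_on_Suc_imp_Ck_on[OF Suc.prems(1)]
        by (intro Ck_on_sum Ck_on_scaleR assms(1) Suc.IH
            Ck_on_bounded_linear[OF bounded_linear_inner_left]) auto
    qed
  qed
qed

lemma smooth_on_imp_differentiable: "smooth_on S f \<Longrightarrow> x \<in> S \<Longrightarrow> f differentiable (at x)"
  unfolding smooth_on_def by (drule spec[of _ "Suc 0"]) simp

lemma smooth_on_frechet_derivative: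
  "smooth_on S f \<Longrightarrow> smooth_on S (\<lambda>x. frechet_derivative f (at x) v)"
  unfolding smooth_on_def
proof
  fix k
  assume "\<forall>k. Ck_on k S f"
  then have "Ck_on (Suc k) S f" ..
  then show "Ck_on k S (\<lambda>x. frechet_derivative f (at x) v)"
    by simp
qed

lemma smooth_on_transform:
  "open S \<Longrightarrow> smooth_on S f \<Longrightarrow> (\<And>x. x \<in> S \<Longrightarrow> f x = h x) \<Longrightarrow> smooth_on S h"
  unfolding smooth_on_def using Ck_on_cong by blast

lemma smooth_on_subset: "smooth_on S f \<Longrightarrow> S' \<subseteq> S \<Longrightarrow> smooth_on S' f"
  unfolding smooth_on_def using Ck_on_subset by blast

lemma smooth_on_const: "open S \<Longrightarrow> smooth_on S (\<lambda>x. c)"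
  unfolding smooth_on_def by (simp add: Ck_on_const)

lemma smooth_on_bounded_linear:
  "bounded_linear L \<Longrightarrow> open S \<Longrightarrow> smooth_on S f \<Longrightarrow> smooth_on S (\<lambda>x. L (f x))"
  unfolding smooth_on_def by (simp add: Ck_on_bounded_linear)

lemma smooth_on_add:
  "open S \<Longrightarrow> smooth_on S f \<Longrightarrow> smooth_on S h \<Longrightarrow> smooth_on S (\<lambda>x. f x + h x)"
  unfolding smooth_on_def by (simp add: Ck_on_add)

lemma smooth_on_sum:
  "open S \<Longrightarrow> (\<And>i. i \<in> J \<Longrightarrow> smooth_on S (f i)) \<Longrightarrow> smooth_on S (\<lambda>x. \<Sum>i\<in>J. f i x)"
  unfolding smooth_on_def by (simp add: Ck_on_sum)

lemma smooth_on_scaleR: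
  "open S \<Longrightarrow> smooth_on S f \<Longrightarrow> smooth_on S h \<Longrightarrow> smooth_on S (\<lambda>x. f x *\<^sub>R h x)"
  unfolding smooth_on_def by (simp add: Ck_on_scaleR)

lemma smooth_on_compose:
  fixes f :: "'v::euclidean_space \<Rightarrow> 'w::real_normed_vector"
  assumes "open S" "open S'" "h ` S \<subseteq> S'" "smooth_on S h" "smooth_on S' f"
  shows "smooth_on S (\<lambda>x. f (h x))"
  using assms unfolding smooth_on_def by (blast intro: Ck_on_compose)

lemma smooth_on_vec_nth:
  fixes f :: "'v::real_normed_vector \<Rightarrow> real^3"
  shows "open S \<Longrightarrow> smooth_on S f \<Longrightarrow> smooth_on S (\<lambda>x. f x $ i)"
  by (rule smooth_on_bounded_linear[OF bounded_linear_vec_nth])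

section \<open>Charts and tangent vectors\<close>

lemma comp_add [simp]: "comp (v + w) c = comp v c + comp w c"
  by (simp add: plus_tangent.rep_eq)

lemma comp_scaleR [simp]: "comp (r *\<^sub>R v) c = r *\<^sub>R comp v c"
  by (simp add: scaleR_tangent.rep_eq)

lemma comp_zero [simp]: "comp 0 c = 0"
  by (simp add: zero_tangent.rep_eq)

lemma comp_sum: "comp (\<Sum>i\<in>J. v i) c = (\<Sum>i\<in>J. comp (v i) c)"
  by (induction J rule: infinite_finite_induct) auto

locale manifold_atlas =
  fixes X :: "'a topology" and A :: "'a chart set"
  assumes mfd: "smooth_manifold X A"
begin

lemma chart_on: "c \<in> A \<Longrightarrow> chart_on X c"
  using mfd by (simp add: smooth_manifold_def)

lemma chart_openin: "c \<in> A \<Longrightarrow> openin X (fst c)"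
  using chart_on by (auto simp: chart_on_def)

lemma chart_subset: "c \<in> A \<Longrightarrow> fst c \<subseteq> topspace X"
  by (simp add: chart_openin openin_subset)

lemma chart_homeomorphic:
  "c \<in> A \<Longrightarrow> homeomorphic_map (subtopology X (fst c)) (top_of_set (snd c ` fst c)) (snd c)"
  using chart_on by (auto simp: chart_on_def)

lemma chart_inj: "c \<in> A \<Longrightarrow> inj_on (snd c) (fst c)"
  using homeomorphic_imp_injective_map[OF chart_homeomorphic] chart_subset
  by (metis inf_absorb2 topspace_subtopology)

lemma chart_inv_chart [simp]: "c \<in> A \<Longrightarrow> p \<in> fst c \<Longrightarrow> chart_inv c (snd c p) = p"
  by (simp add: chart_inv_def chart_inj)

lemma chart_image_open:
  assumes "c \<in> A" "openin X U"
  shows "open (snd c ` (U \<inter> fst c))"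
proof -
  have "openin (subtopology X (fst c)) (U \<inter> fst c)"
    using assms by (auto simp: openin_subtopology)
  then have "openin (top_of_set (snd c ` fst c)) (snd c ` (U \<inter> fst c))"
    using homeomorphic_imp_open_map[OF chart_homeomorphic[OF assms(1)]] by (simp add: open_map_def)
  moreover have "open (snd c ` fst c)"
    using chart_on[OF assms(1)] by (simp add: chart_on_def)
  ultimately show ?thesis
    using openin_open_trans by blast
qed

lemma chart_at: "p \<in> topspace X \<Longrightarrow> chart_at A p \<in> A \<and> p \<in> fst (chart_at A p)"
proof -
  assume "p \<in> topspace X"
  then have "\<exists>c. c \<in> A \<and> p \<in> fst c"
    using mfd unfolding smooth_manifold_def by blast
  then show ?thesis
    unfolding chart_at_def by (rule someI_ex)
qed

lemma transition_chart: "c \<in> A \<Longrightarrow> p \<in> fst c \<Longrightarrow> transition c c' (snd c p) = snd c' p"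
  by (simp add: transition_def)

lemma transition_smooth:
  "c \<in> A \<Longrightarrow> c' \<in> A \<Longrightarrow> smooth_on (snd c ` (fst c \<inter> fst c')) (transition c c')"
  using mfd by (simp add: smooth_manifold_def)

lemma overlap_open: "c \<in> A \<Longrightarrow> c' \<in> A \<Longrightarrow> open (snd c ` (fst c \<inter> fst c'))"
  using chart_image_open[of c "fst c'"] chart_openin by (simp add: Int_commute)

lemma transition_differentiable:
  "c \<in> A \<Longrightarrow> c' \<in> A \<Longrightarrow> p \<in> fst c \<Longrightarrow> p \<in> fst c' \<Longrightarrow> transition c c' differentiable (at (snd c p))"
  by (rule smooth_on_imp_differentiable[OF transition_smooth]) auto

lemma transition_derivative_linear:
  "c \<in> A \<Longrightarrow> c' \<in> A \<Longrightarrow> p \<in> fst c \<Longrightarrow> p \<in> fst c' \<Longrightarrow>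
     linear (frechet_derivative (transition c c') (at (snd c p)))"
  by (simp add: linear_frechet_derivative transition_differentiable)

text \<open>This is the chain rule; the transition maps compose as expected only on the image of the
  triple overlap, which is open. The identity is exactly the compatibility that makes coordinate
  fields tangent.\<close>

lemma transition_derivative_cocycle:
  assumes "c \<in> A" "c' \<in> A" "c'' \<in> A" "p \<in> fst c" "p \<in> fst c'" "p \<in> fst c''"
  shows "frechet_derivative (transition c c'') (at (snd c p)) v =
    frechet_derivative (transition c' c'') (at (snd c' p))
      (frechet_derivative (transition c c') (at (snd c p)) v)"
proof -
  let ?S = "snd c ` ((fst c' \<inter> fst c'') \<inter> fst c)"
  have "open ?S"
    using assms by (intro chart_image_open openin_Int chart_openin)
  moreover have "transition c c'' x = (transition c' c'' \<circ> transition c c') x" if "x \<in> ?S" for x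
    using that assms by (auto simp: transition_chart)
  ultimately have "frechet_derivative (transition c c'') (at (snd c p)) =
      frechet_derivative (transition c' c'' \<circ> transition c c') (at (snd c p))"
    using assms
    by (intro frechet_derivative_transform_within_open[where X = ?S] transition_differentiable) auto
  also have "\<dots> = frechet_derivative (transition c' c'') (at (snd c' p)) \<circ>
      frechet_derivative (transition c c') (at (snd c p))"
    using assms frechet_derivative_compose[of "transition c c'" "snd c p" "transition c' c''"]
    by (simp add: transition_chart transition_differentiable)
  finally show ?thesis
    by simp
qed

lemma transition_derivative_self:
  assumes "c \<in> A" "p \<in> fst c"
  shows "frechet_derivative (transition c c) (at (snd c p)) v = v"
proof -
  have "open (snd c ` (fst c \<inter> fst c))"
    using assms by (intro overlap_open)
  then have "frechet_derivative (transition c c) (at (snd c p)) =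
      frechet_derivative (\<lambda>x. x) (at (snd c p))"
    using assms
    by (intro frechet_derivative_transform_within_open[where X = "snd c ` (fst c \<inter> fst c)"]
        transition_differentiable) (auto simp: transition_chart)
  then show ?thesis
    by simp
qed

section \<open>Tangent spaces and coordinate vector fields\<close>

lemma tangent_spaceI:
  assumes "\<And>c c'. c \<in> A \<Longrightarrow> c' \<in> A \<Longrightarrow> p \<in> fst c \<Longrightarrow> p \<in> fst c' \<Longrightarrow>
      comp v c' = frechet_derivative (transition c c') (at (snd c p)) (comp v c)"
    and "\<And>c. \<not> (c \<in> A \<and> p \<in> fst c) \<Longrightarrow> comp v c = 0"
  shows "v \<in> tangent_space A p"
  unfolding tangent_space_def using assms by blast

lemma tangent_transform:
  assumes "v \<in> tangent_space A p" "c \<in> A" "c' \<in> A" "p \<in> fst c" "p \<in> fst c'"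
  shows "comp v c' = frechet_derivative (transition c c') (at (snd c p)) (comp v c)"
  using assms unfolding tangent_space_def by blast

lemma tangent_vanishes:
  "v \<in> tangent_space A p \<Longrightarrow> \<not> (c \<in> A \<and> p \<in> fst c) \<Longrightarrow> comp v c = 0"
  unfolding tangent_space_def by blast

lemma tangent_space_subspace: "subspace (tangent_space A p)"
  unfolding subspace_def
proof (intro conjI ballI allI)
  show "0 \<in> tangent_space A p"
    by (rule tangent_spaceI) (simp_all add: linear_0 transition_derivative_linear)
  show "v + w \<in> tangent_space A p" if "v \<in> tangent_space A p" "w \<in> tangent_space A p" for v w
  proof (rule tangent_spaceI)
    fix c c' assume "c \<in> A" "c' \<in> A" "p \<in> fst c" "p \<in> fst c'"
    then show "comp (v + w) c' = frechet_derivative (transition c c') (at (snd c p)) (comp (v + w) c)"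
      using tangent_transform[OF that(1), of c c'] tangent_transform[OF that(2), of c c']
      by (simp add: linear_add transition_derivative_linear)
  qed (use that in \<open>simp add: tangent_vanishes\<close>)
  show "r *\<^sub>R v \<in> tangent_space A p" if "v \<in> tangent_space A p" for r v
  proof (rule tangent_spaceI)
    fix c c' assume "c \<in> A" "c' \<in> A" "p \<in> fst c" "p \<in> fst c'"
    then show "comp (r *\<^sub>R v) c' = frechet_derivative (transition c c') (at (snd c p)) (comp (r *\<^sub>R v) c)"
      using tangent_transform[OF that, of c c']
      by (simp add: linear_scale transition_derivative_linear)
  qed (use that in \<open>simp add: tangent_vanishes\<close>)
qed

text \<open>The Jacobians propagate the column in one chart to all charts around \<open>p\<close>,
  and the remaining columns are zero by convention. Equations between tangent vectors can thus be
  checked in a single chart.\<close>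

lemma tangent_eqI:
  assumes "v \<in> tangent_space A p" "w \<in> tangent_space A p" "c \<in> A" "p \<in> fst c"
    and "comp v c = comp w c"
  shows "v = w"
proof -
  have "comp v c' = comp w c'" for c'
    using assms tangent_transform[of _ p c c'] tangent_vanishes[of _ p c']
    by (cases "c' \<in> A \<and> p \<in> fst c'") auto
  then show ?thesis
    by (metis comp_inject ext)
qed

lemma comp_coord_field:
  "comp (coord_field A c i p) c' = (if c' \<in> A \<and> p \<in> fst c \<inter> fst c'
     then frechet_derivative (transition c c') (at (snd c p)) (axis i 1) else 0)"
  by (simp add: coord_field_def Tangent_inverse)

lemma comp_coord_field_self: "c \<in> A \<Longrightarrow> p \<in> fst c \<Longrightarrow> comp (coord_field A c i p) c = axis i 1"
  by (simp add: comp_coord_field transition_derivative_self)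

lemma coord_field_tangent: "c \<in> A \<Longrightarrow> p \<in> fst c \<Longrightarrow> coord_field A c i p \<in> tangent_space A p"
  by (rule tangent_spaceI) (auto simp: comp_coord_field intro: transition_derivative_cocycle)

lemma tangent_expansion:
  assumes "c \<in> A" "p \<in> fst c" "v \<in> tangent_space A p"
  shows "v = (\<Sum>i\<in>UNIV. (comp v c $ i) *\<^sub>R coord_field A c i p)"
proof (rule tangent_eqI[OF _ _ assms(1,2)])
  show "(\<Sum>i\<in>UNIV. (comp v c $ i) *\<^sub>R coord_field A c i p) \<in> tangent_space A p"
    using assms by (intro subspace_sum subspace_scale tangent_space_subspace coord_field_tangent)
  show "comp v c = comp (\<Sum>i\<in>UNIV. (comp v c $ i) *\<^sub>R coord_field A c i p) c"
    using basis_expansion[of "comp v c"] assms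
    by (simp add: comp_sum comp_coord_field_self scalar_mult_eq_scaleR)
qed (use assms in auto)

text \<open>Columns in one chart embed the tangent space into \<open>real^3\<close>, where an
  injective linear endomorphism is surjective. This serves both the slant basis and the Frenet
  frames.\<close>

lemma tangent_spanned_by_three:
  assumes p: "p \<in> topspace X"
    and uvw: "u \<in> tangent_space A p" "v \<in> tangent_space A p" "w \<in> tangent_space A p"
    and indep: "\<And>x y z. x *\<^sub>R u + y *\<^sub>R v + z *\<^sub>R w = 0 \<Longrightarrow> x = 0 \<and> y = 0 \<and> z = 0"
    and q: "q \<in> tangent_space A p"
  shows "\<exists>x y z. q = x *\<^sub>R u + y *\<^sub>R v + z *\<^sub>R w"
proof -
  obtain c where c: "c \<in> A" "p \<in> fst c"
    using chart_at[OF p] by blast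
  define L where "L x = (x $ 1) *\<^sub>R comp u c + (x $ 2) *\<^sub>R comp v c + (x $ 3) *\<^sub>R comp w c"
    for x :: "real^3"
  have lin: "linear L"
    unfolding L_def by (rule linearI) (auto simp: algebra_simps)
  have mem: "x *\<^sub>R u + y *\<^sub>R v + z *\<^sub>R w \<in> tangent_space A p" for x y z
    using uvw by (intro subspace_add subspace_scale tangent_space_subspace)
  have "x = 0" if "L x = 0" for x
  proof -
    have "(x $ 1) *\<^sub>R u + (x $ 2) *\<^sub>R v + (x $ 3) *\<^sub>R w = 0"
      using that by (intro tangent_eqI[OF mem subspace_0[OF tangent_space_subspace] c])
        (simp add: L_def)
    then show "x = 0"
      using indep by (auto simp: vec_eq_iff forall_3)
  qed
  then have "inj L"
    using lin linear_injective_0 by blast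
  then have "surj L"
    using lin linear_injective_imp_surjective by blast
  then obtain x where "comp q c = L x"
    by (metis surjD)
  then have "q = (x $ 1) *\<^sub>R u + (x $ 2) *\<^sub>R v + (x $ 3) *\<^sub>R w"
    by (intro tangent_eqI[OF q mem c]) (simp add: L_def)
  then show ?thesis
    by blast
qed


section \<open>Smooth functions and vector fields\<close>

text \<open>In a second chart \<open>c'\<close> the column of the field is a column of the Jacobian
  of \<open>transition c c'\<close>, taken at the \<open>c\<close>-coordinates of the point. As a
  function of the \<open>c'\<close>-coordinates it is therefore composed with
  \<open>transition c' c\<close>.\<close>

lemma coord_field_smooth:
  assumes "c \<in> A"
  shows "smooth_vector_field X A (fst c) (coord_field A c i)"
  unfolding smooth_vector_field_def
proof (intro conjI ballI)
  fix c' assume c': "c' \<in> A"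
  let ?S = "snd c' ` (fst c \<inter> fst c')"
  have S: "?S = snd c' ` (fst c' \<inter> fst c)"
    by (simp add: Int_commute)
  have o: "open ?S"
    unfolding S using assms c' by (intro overlap_open)
  have "smooth_on ?S (\<lambda>x. frechet_derivative (transition c c') (at (transition c' c x)) (axis i 1))"
  proof (rule smooth_on_compose[where h = "transition c' c"
        and f = "\<lambda>y. frechet_derivative (transition c c') (at y) (axis i 1)"])
    show "smooth_on (snd c ` (fst c \<inter> fst c'))
        (\<lambda>y. frechet_derivative (transition c c') (at y) (axis i 1))"
      using assms c' by (intro smooth_on_frechet_derivative transition_smooth)
    show "smooth_on ?S (transition c' c)"
      unfolding S using assms c' by (intro transition_smooth)
    show "transition c' c ` ?S \<subseteq> snd c ` (fst c \<inter> fst c')"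
      using c' by (auto simp: transition_chart)
  qed (use o assms c' in \<open>auto intro: overlap_open\<close>)
  then show "smooth_on ?S (\<lambda>x. comp (coord_field A c i (chart_inv c' x)) c')"
    by (rule smooth_on_transform[OF o])
      (use c' in \<open>auto simp: comp_coord_field transition_chart\<close>)
qed (use assms in \<open>auto intro: chart_openin coord_field_tangent\<close>)

text \<open>On a set inside one chart domain, smoothness in that chart suffices: the expression in
  any other chart differs by composition with a transition map.\<close>

lemma smooth_functionI:
  assumes "c \<in> A" "openin X U" "U \<subseteq> fst c" "smooth_on (snd c ` U) (f \<circ> chart_inv c)"
  shows "smooth_function X A U f"
  unfolding smooth_function_def
proof (intro conjI ballI)
  fix c' assume c': "c' \<in> A"
  let ?S = "snd c' ` (U \<inter> fst c')"
  have o: "open ?S"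
    using assms c' by (intro chart_image_open)
  have "smooth_on ?S (\<lambda>x. (f \<circ> chart_inv c) (transition c' c x))"
  proof (rule smooth_on_compose[where h = "transition c' c" and f = "f \<circ> chart_inv c"])
    show "smooth_on ?S (transition c' c)"
      by (rule smooth_on_subset[OF transition_smooth[OF c' assms(1)]]) (use assms in auto)
    show "open (snd c ` U)"
      using chart_image_open[OF assms(1,2)] assms(3) by (simp add: inf_absorb1)
    show "transition c' c ` ?S \<subseteq> snd c ` U"
      using c' by (auto simp: transition_chart)
  qed (use assms o in auto)
  then show "smooth_on ?S (f \<circ> chart_inv c')"
    by (rule smooth_on_transform[OF o])
      (use c' assms in \<open>auto simp: transition_chart\<close>)
qed (use assms in auto)

lemma smooth_function_const: "openin X U \<Longrightarrow> smooth_function X A U (\<lambda>q. r)"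
  unfolding smooth_function_def by (auto simp: o_def intro: smooth_on_const chart_image_open)

lemma smooth_vector_field_add:
  "smooth_vector_field X A U Y \<Longrightarrow> smooth_vector_field X A U Z \<Longrightarrow>
     smooth_vector_field X A U (\<lambda>q. Y q + Z q)"
  unfolding smooth_vector_field_def
  by (auto intro!: smooth_on_add chart_image_open subspace_add tangent_space_subspace)

lemma smooth_vector_field_scale:
  "smooth_function X A U f \<Longrightarrow> smooth_vector_field X A U Y \<Longrightarrow>
     smooth_vector_field X A U (\<lambda>q. f q *\<^sub>R Y q)"
  unfolding smooth_vector_field_def smooth_function_def o_def
  by (auto intro!: smooth_on_scaleR chart_image_open subspace_scale tangent_space_subspace)

lemma smooth_vector_field_zero: "openin X U \<Longrightarrow> smooth_vector_field X A U (\<lambda>q. 0)"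
  unfolding smooth_vector_field_def
  by (auto intro!: smooth_on_const chart_image_open subspace_0 tangent_space_subspace)

lemma smooth_vector_field_sum:
  assumes "openin X U" "\<And>i. i \<in> J \<Longrightarrow> smooth_vector_field X A U (Y i)"
  shows "smooth_vector_field X A U (\<lambda>q. \<Sum>i\<in>J. Y i q)"
  using assms(2)
  by (induction J rule: infinite_finite_induct)
    (auto intro: smooth_vector_field_add smooth_vector_field_zero assms(1))

lemma smooth_vector_field_component:
  assumes "c \<in> A" "U \<subseteq> fst c" "smooth_vector_field X A U Y"
  shows "smooth_function X A U (\<lambda>q. comp (Y q) c $ i)"
proof (rule smooth_functionI[OF assms(1)])
  have "snd c ` (U \<inter> fst c) = snd c ` U"
    using assms(2) by (simp add: inf_absorb1)
  moreover from this have "smooth_on (snd c ` U) (\<lambda>x. comp (Y (chart_inv c x)) c)"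
    using assms by (auto simp: smooth_vector_field_def)
  moreover have "open (snd c ` (U \<inter> fst c))"
    using assms by (auto simp: smooth_vector_field_def intro: chart_image_open)
  ultimately show "smooth_on (snd c ` U) ((\<lambda>q. comp (Y q) c $ i) \<circ> chart_inv c)"
    by (simp add: o_def smooth_on_vec_nth)
qed (use assms in \<open>auto simp: smooth_vector_field_def\<close>)

text \<open>Freezing the coefficients with respect to the coordinate fields extends a single vector.
  Through it, identities quantified over vector fields can be applied to vectors given only at one
  point.\<close>

lemma tangent_extension:
  assumes "c \<in> A" "p \<in> fst c" "v \<in> tangent_space A p"
  obtains Y where "smooth_vector_field X A (fst c) Y" "Y p = v"
proof
  show "smooth_vector_field X A (fst c)
      (\<lambda>q. \<Sum>i\<in>UNIV. (comp v c $ i) *\<^sub>R coord_field A c i q)"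
    using assms
    by (intro smooth_vector_field_sum smooth_vector_field_scale smooth_function_const
        coord_field_smooth chart_openin)
qed (use tangent_expansion[OF assms] in simp)

end

section \<open>Curves and vector fields along them\<close>

locale atlas_curve = manifold_atlas X A
  for X :: "'a topology" and A :: "'a chart set" +
  fixes I :: "real set" and C :: "real \<Rightarrow> 'a"
  assumes curve: "smooth_curve X A I C"
begin

lemma curve_in_topspace: "t \<in> I \<Longrightarrow> C t \<in> topspace X"
  using curve continuous_map_image_subset_topspace[of "top_of_set I" X C]
  by (auto simp: smooth_curve_def)

lemma curve_preimage_open:
  assumes "openin X U"
  shows "open {t\<in>I. C t \<in> U}"
proof -
  have "openin (top_of_set I) {t \<in> topspace (top_of_set I). C t \<in> U}"
    using curve assms by (intro openin_continuous_map_preimage) (auto simp: smooth_curve_def)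
  then show ?thesis
    using curve openin_open_trans by (auto simp: smooth_curve_def)
qed

lemma coordinate_curve_smooth: "c \<in> A \<Longrightarrow> smooth_on {t\<in>I. C t \<in> fst c} (\<lambda>t. snd c (C t))"
  using curve by (simp add: smooth_curve_def o_def)

lemma comp_velocity:
  "c \<in> A \<Longrightarrow> C t \<in> fst c \<Longrightarrow> comp (velocity A C t) c = vector_derivative (\<lambda>s. snd c (C s)) (at t)"
  by (simp add: velocity_def Tangent_inverse o_def)

lemma coordinate_curve_differentiable:
  "c \<in> A \<Longrightarrow> t \<in> I \<Longrightarrow> C t \<in> fst c \<Longrightarrow> (\<lambda>s. snd c (C s)) differentiable (at t)"
  by (rule smooth_on_imp_differentiable[OF coordinate_curve_smooth]) auto

lemma coordinate_curve_velocity: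
  assumes "c \<in> A" "t \<in> I" "C t \<in> fst c"
  shows "((\<lambda>s. snd c (C s)) has_vector_derivative comp (velocity A C t) c) (at t)"
  using coordinate_curve_differentiable[OF assms] assms
  by (simp add: comp_velocity vector_derivative_works)

lemma coordinate_chain_rule:
  assumes "c \<in> A" "t \<in> I" "C t \<in> fst c" "f differentiable (at (snd c (C t)))"
  shows "((\<lambda>s. f (snd c (C s))) has_vector_derivative
      frechet_derivative f (at (snd c (C t))) (comp (velocity A C t) c)) (at t)"
proof -
  have "(f has_derivative frechet_derivative f (at (snd c (C t))))
      (at (snd c (C t)) within (\<lambda>s. snd c (C s)) ` UNIV)"
    using has_derivative_frechet[OF assms(4)] by (rule has_derivative_at_withinI)
  then show ?thesis
    using vector_derivative_diff_chain_within[OF coordinate_curve_velocity[OF assms(1-3)]]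
    by (simp add: o_def)
qed

lemma velocity_tangent:
  assumes "t \<in> I"
  shows "velocity A C t \<in> tangent_space A (C t)"
proof (rule tangent_spaceI)
  fix c c' assume c: "c \<in> A" "c' \<in> A" "C t \<in> fst c" "C t \<in> fst c'"
  have "((\<lambda>s. transition c c' (snd c (C s))) has_vector_derivative
      frechet_derivative (transition c c') (at (snd c (C t))) (comp (velocity A C t) c)) (at t)"
    using c assms by (intro coordinate_chain_rule transition_differentiable)
  then have "((\<lambda>s. snd c' (C s)) has_vector_derivative
      frechet_derivative (transition c c') (at (snd c (C t))) (comp (velocity A C t) c)) (at t)"
    by (rule has_vector_derivative_transform_within_open[OF _ curve_preimage_open[OF chart_openin]])
      (use c assms in \<open>auto simp: transition_chart\<close>)
  then show "comp (velocity A C t) c' =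
      frechet_derivative (transition c c') (at (snd c (C t))) (comp (velocity A C t) c)"
    using c by (simp add: comp_velocity vector_derivative_at)
qed (auto simp: velocity_def Tangent_inverse)

lemma velocity_smooth: "smooth_field_along A I C (velocity A C)"
  unfolding smooth_field_along_def
proof (intro conjI ballI)
  fix c assume c: "c \<in> A"
  let ?S = "{t\<in>I. C t \<in> fst c}"
  have "smooth_on ?S (\<lambda>t. frechet_derivative (\<lambda>s. snd c (C s)) (at t) 1)"
    using c by (intro smooth_on_frechet_derivative coordinate_curve_smooth)
  then show "smooth_on ?S (\<lambda>t. comp (velocity A C t) c)"
  proof (rule smooth_on_transform[rotated])
    fix t assume t: "t \<in> ?S"
    then have "((\<lambda>s. snd c (C s)) has_derivative (\<lambda>x. x *\<^sub>R comp (velocity A C t) c)) (at t)"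
      using coordinate_curve_velocity[OF c] by (simp add: has_vector_derivative_def)
    then show "frechet_derivative (\<lambda>s. snd c (C s)) (at t) 1 = comp (velocity A C t) c"
      using frechet_derivative_at by (metis scaleR_one)
  qed (use c in \<open>auto intro: curve_preimage_open chart_openin\<close>)
qed (use velocity_tangent in auto)

text \<open>Directional derivatives and covariant derivatives along the curve at a point both use the
  chart selected by \<open>chart_at\<close>, so their values never have to be compared between charts.\<close>

lemma curve_chain_rule:
  assumes "smooth_function X A U f" "t \<in> I" "C t \<in> U"
  shows "((\<lambda>s. f (C s)) has_vector_derivative dir_deriv A (C t) (velocity A C t) f) (at t)"
proof -
  define c where "c = chart_at A (C t)"
  have c: "c \<in> A" "C t \<in> fst c"
    using chart_at curve_in_topspace[OF assms(2)] unfolding c_def by auto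
  have "(f \<circ> chart_inv c) differentiable (at (snd c (C t)))"
    using assms c by (intro smooth_on_imp_differentiable[of "snd c ` (U \<inter> fst c)"])
      (auto simp: smooth_function_def)
  then have "((\<lambda>s. (f \<circ> chart_inv c) (snd c (C s))) has_vector_derivative
      frechet_derivative (f \<circ> chart_inv c) (at (snd c (C t))) (comp (velocity A C t) c)) (at t)"
    using assms c by (intro coordinate_chain_rule)
  then have "((\<lambda>s. f (C s)) has_vector_derivative
      frechet_derivative (f \<circ> chart_inv c) (at (snd c (C t))) (comp (velocity A C t) c)) (at t)"
    by (rule has_vector_derivative_transform_within_open[OF _ curve_preimage_open[OF chart_openin]])
      (use c assms in auto)
  then show ?thesis
    by (simp add: dir_deriv_def c_def Let_def)
qed

lemma vector_field_along:
  assumes "smooth_vector_field X A U Y" "c \<in> A"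
  shows "smooth_on {t\<in>I. C t \<in> U \<inter> fst c} (\<lambda>t. comp (Y (C t)) c)"
proof -
  let ?S = "{t\<in>I. C t \<in> U \<inter> fst c}"
  have U: "openin X U"
    using assms by (simp add: smooth_vector_field_def)
  have S: "open ?S"
    using U assms by (intro curve_preimage_open openin_Int chart_openin)
  have "smooth_on ?S (\<lambda>t. (\<lambda>x. comp (Y (chart_inv c x)) c) (snd c (C t)))"
  proof (rule smooth_on_compose[where f = "\<lambda>x. comp (Y (chart_inv c x)) c"
        and h = "\<lambda>t. snd c (C t)"])
    show "smooth_on (snd c ` (U \<inter> fst c)) (\<lambda>x. comp (Y (chart_inv c x)) c)"
      using assms by (simp add: smooth_vector_field_def)
    show "smooth_on ?S (\<lambda>t. snd c (C t))"
      by (rule smooth_on_subset[OF coordinate_curve_smooth[OF assms(2)]]) auto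
  qed (use S U assms in \<open>auto intro: chart_image_open\<close>)
  then show ?thesis
    by (rule smooth_on_transform[OF S]) (use assms in auto)
qed

lemma smooth_field_along_vector_field:
  assumes "smooth_vector_field X A (topspace X) Y"
  shows "smooth_field_along A I C (\<lambda>t. Y (C t))"
  unfolding smooth_field_along_def
proof (intro conjI ballI)
  fix c assume c: "c \<in> A"
  have "{t\<in>I. C t \<in> topspace X \<inter> fst c} = {t\<in>I. C t \<in> fst c}"
    using curve_in_topspace by auto
  then show "smooth_on {t\<in>I. C t \<in> fst c} (\<lambda>t. comp (Y (C t)) c)"
    using vector_field_along[OF assms c] by simp
qed (use assms curve_in_topspace in \<open>auto simp: smooth_vector_field_def\<close>)

lemma smooth_field_along_tangent:
  "smooth_field_along A I C V \<Longrightarrow> t \<in> I \<Longrightarrow> V t \<in> tangent_space A (C t)"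
  by (simp add: smooth_field_along_def)

lemma smooth_field_along_add:
  "smooth_field_along A I C V \<Longrightarrow> smooth_field_along A I C W \<Longrightarrow>
     smooth_field_along A I C (\<lambda>t. V t + W t)"
  unfolding smooth_field_along_def
  by (auto intro!: smooth_on_add curve_preimage_open chart_openin subspace_add tangent_space_subspace)

lemma smooth_field_along_scale:
  "smooth_field_along A I C V \<Longrightarrow> smooth_field_along A I C (\<lambda>t. r *\<^sub>R V t)"
  unfolding smooth_field_along_def
  by (auto intro!: smooth_on_scaleR smooth_on_const curve_preimage_open chart_openin
      subspace_scale tangent_space_subspace)

lemma smooth_field_along_component:
  assumes "smooth_field_along A I C V" "c \<in> A" "t \<in> I" "C t \<in> fst c"
  shows "((\<lambda>s. comp (V s) c $ i) has_vector_derivative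
      vector_derivative (\<lambda>s. comp (V s) c $ i) (at t)) (at t)"
proof -
  have "smooth_on {t\<in>I. C t \<in> fst c} (\<lambda>s. comp (V s) c $ i)"
    using assms by (intro smooth_on_vec_nth curve_preimage_open chart_openin)
      (auto simp: smooth_field_along_def)
  then show ?thesis
    unfolding vector_derivative_works[symmetric]
    by (rule smooth_on_imp_differentiable) (use assms in auto)
qed

end


section \<open>The covariant derivative along a curve\<close>

text \<open>Linearity is required on a subspace only, since \<open>\<phi>\<close>,
  \<open>\<eta>\<close> and \<open>g\<close> are specified on tangent spaces and not on the ambient
  type of all families.\<close>

lemma linear_on_sum:
  fixes L :: "'v::real_vector \<Rightarrow> 'w::real_vector"
  assumes "subspace S" "finite J"
    and lin: "\<And>v w r s. v \<in> S \<Longrightarrow> w \<in> S \<Longrightarrow> L (r *\<^sub>R v + s *\<^sub>R w) = r *\<^sub>R L v + s *\<^sub>R L w"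
    and "\<And>i. i \<in> J \<Longrightarrow> v i \<in> S"
  shows "L (\<Sum>i\<in>J. r i *\<^sub>R v i) = (\<Sum>i\<in>J. r i *\<^sub>R L (v i))"
  using assms(2,4)
proof (induction J rule: finite_induct)
  case empty
  show ?case
    using lin[of 0 0 0 0] assms(1) by (simp add: subspace_0)
next
  case (insert j J)
  have "(\<Sum>i\<in>J. r i *\<^sub>R v i) \<in> S"
    using insert assms(1) by (intro subspace_sum subspace_scale) auto
  then show ?case
    using insert lin[of "v j" "\<Sum>i\<in>J. r i *\<^sub>R v i" "r j" 1] by simp
qed

locale connection_curve = atlas_curve X A I C
  for X :: "'a topology" and A :: "'a chart set" and I C +
  fixes nabla :: "'a conn"
  assumes conn: "affine_connection X A nabla"
begin

context
  fixes U p v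
  assumes p: "p \<in> U" and v: "v \<in> tangent_space A p"
begin

lemmas nabla_rules =
  conn[unfolded affine_connection_def, THEN spec, THEN spec, THEN mp, THEN conjunct1,
    THEN bspec, OF _ p, THEN bspec, OF _ v]

lemma nabla_tangent: "smooth_vector_field X A U Y \<Longrightarrow> nabla p v Y \<in> tangent_space A p"
  by (rule nabla_rules[THEN conjunct1])

lemma nabla_add:
  "smooth_vector_field X A U Y \<Longrightarrow> smooth_vector_field X A U Z \<Longrightarrow>
     nabla p v (\<lambda>q. Y q + Z q) = nabla p v Y + nabla p v Z"
  by (rule nabla_rules[THEN conjunct2, THEN conjunct2, THEN conjunct1, THEN spec, THEN mp])

lemma nabla_scale:
  "smooth_function X A U f \<Longrightarrow> smooth_vector_field X A U Y \<Longrightarrow>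
     nabla p v (\<lambda>q. f q *\<^sub>R Y q) = dir_deriv A p v f *\<^sub>R Y p + f p *\<^sub>R nabla p v Y"
  by (rule nabla_rules[THEN conjunct2, THEN conjunct2, THEN conjunct2, THEN conjunct2,
        THEN spec, THEN mp])

lemma nabla_cong:
  "smooth_vector_field X A U Y \<Longrightarrow> smooth_vector_field X A U Z \<Longrightarrow> (\<And>q. q \<in> U \<Longrightarrow> Z q = Y q) \<Longrightarrow>
     nabla p v Z = nabla p v Y"
  by (rule nabla_rules[THEN conjunct2, THEN conjunct2, THEN conjunct2, THEN conjunct1,
        THEN spec, THEN mp]) auto

lemma nabla_sum:
  assumes "finite J" "openin X U" "\<And>i. i \<in> J \<Longrightarrow> smooth_vector_field X A U (Y i)"
  shows "nabla p v (\<lambda>q. \<Sum>i\<in>J. Y i q) = (\<Sum>i\<in>J. nabla p v (Y i))"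
  using assms(1,3)
proof (induction J rule: finite_induct)
  case empty
  show ?case
    \<comment> \<open>Additivity applied to the zero field reads \<open>n = n + n\<close>, hence
      \<open>n = 0\<close>.\<close>
    using nabla_add[OF smooth_vector_field_zero smooth_vector_field_zero, OF assms(2,2)] by simp
next
  case (insert j J)
  then show ?case
    using assms(2) by (simp add: nabla_add smooth_vector_field_sum)
qed

end

text \<open>The Leibniz rule applied to the expansion in coordinate fields. The result has the shape
  of \<open>cov_deriv_along\<close>, with directional derivatives in place of time derivatives of
  the coefficients.\<close>

lemma nabla_coordinates:
  assumes c: "c \<in> A" "p \<in> fst c" and v: "v \<in> tangent_space A p"
    and Y: "smooth_vector_field X A (fst c) Y"
  shows "nabla p v Y = (\<Sum>k\<in>UNIV. dir_deriv A p v (\<lambda>q. comp (Y q) c $ k) *\<^sub>R coord_field A c k p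
      + (comp (Y p) c $ k) *\<^sub>R nabla p v (coord_field A c k))"
proof -
  have sm: "smooth_vector_field X A (fst c) (\<lambda>q. (comp (Y q) c $ k) *\<^sub>R coord_field A c k q)" for k
    using c Y
    by (intro smooth_vector_field_scale smooth_vector_field_component coord_field_smooth) auto
  have "nabla p v Y = nabla p v (\<lambda>q. \<Sum>k\<in>UNIV. (comp (Y q) c $ k) *\<^sub>R coord_field A c k q)"
  proof (rule nabla_cong[OF c(2) v])
    show "Y q = (\<Sum>k\<in>UNIV. (comp (Y q) c $ k) *\<^sub>R coord_field A c k q)" if "q \<in> fst c" for q
      using that c Y by (intro tangent_expansion) (auto simp: smooth_vector_field_def)
  qed (use c Y sm in \<open>auto intro: smooth_vector_field_sum chart_openin\<close>)
  also have "\<dots> = (\<Sum>k\<in>UNIV. nabla p v (\<lambda>q. (comp (Y q) c $ k) *\<^sub>R coord_field A c k q))"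
    using c sm by (intro nabla_sum[OF c(2) v] chart_openin) auto
  also have "\<dots> = (\<Sum>k\<in>UNIV. dir_deriv A p v (\<lambda>q. comp (Y q) c $ k) *\<^sub>R coord_field A c k p
      + (comp (Y p) c $ k) *\<^sub>R nabla p v (coord_field A c k))"
    using c Y
    by (intro sum.cong refl nabla_scale[OF c(2) v] smooth_vector_field_component coord_field_smooth)
      auto
  finally show ?thesis .
qed

abbreviation D :: "(real \<Rightarrow> 'a tangent) \<Rightarrow> real \<Rightarrow> 'a tangent" where
  "D \<equiv> cov_deriv_along A nabla C"

text \<open>A Leibniz rule for arbitrary smooth fields \<open>Y i\<close> on the chart, not just
  coordinate fields. The case \<open>Y i = \<phi> e_i\<close> is what brings the covariant
  derivative of \<open>\<phi>\<close> into play.\<close>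

lemma cov_deriv_along_combination:
  fixes f :: "3 \<Rightarrow> real \<Rightarrow> real"
  assumes t: "t \<in> I" and c: "c = chart_at A (C t)"
    and Y: "\<And>i. smooth_vector_field X A (fst c) (Y i)"
    and f: "\<And>i. (f i has_vector_derivative f' i) (at t)"
    and V: "\<And>s. s \<in> I \<Longrightarrow> C s \<in> fst c \<Longrightarrow> V s = (\<Sum>i\<in>UNIV. f i s *\<^sub>R Y i (C s))"
  shows "D V t = (\<Sum>i\<in>UNIV. f' i *\<^sub>R Y i (C t) + f i t *\<^sub>R nabla (C t) (velocity A C t) (Y i))"
proof -
  let ?p = "C t" and ?T = "velocity A C t"
  have cA: "c \<in> A" "?p \<in> fst c"
    using chart_at curve_in_topspace[OF t] c by auto
  note T = velocity_tangent[OF t]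
  define y where "y i k q = comp (Y i q) c $ k" for i k q
  have y: "((\<lambda>s. y i k (C s)) has_vector_derivative dir_deriv A ?p ?T (y i k)) (at t)" for i k
    unfolding y_def
    using cA Y t by (intro curve_chain_rule[of "fst c"] smooth_vector_field_component) auto
  have "((\<lambda>s. \<Sum>i\<in>UNIV. f i s * y i k (C s)) has_vector_derivative
      (\<Sum>i\<in>UNIV. f i t * dir_deriv A ?p ?T (y i k) + f' i * y i k ?p)) (at t)" for k
    using f y by (intro has_vector_derivative_sum has_vector_derivative_mult) auto
  then have "((\<lambda>s. comp (V s) c $ k) has_vector_derivative
      (\<Sum>i\<in>UNIV. f i t * dir_deriv A ?p ?T (y i k) + f' i * y i k ?p)) (at t)" for k
    by (rule has_vector_derivative_transform_within_open[OF _ curve_preimage_open[OF chart_openin]])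
      (use cA t V in \<open>auto simp: comp_sum y_def\<close>)
  then have dV: "vector_derivative (\<lambda>s. comp (V s) c $ k) (at t) =
      (\<Sum>i\<in>UNIV. f i t * dir_deriv A ?p ?T (y i k) + f' i * y i k ?p)" for k
    by (simp add: vector_derivative_at)
  have V0: "comp (V t) c $ k = (\<Sum>i\<in>UNIV. f i t * y i k ?p)" for k
    using V[OF t] cA by (simp add: comp_sum y_def)
  have "D V t = (\<Sum>k\<in>UNIV.
      (\<Sum>i\<in>UNIV. f i t * dir_deriv A ?p ?T (y i k) + f' i * y i k ?p) *\<^sub>R coord_field A c k ?p +
      (\<Sum>i\<in>UNIV. f i t * y i k ?p) *\<^sub>R nabla ?p ?T (coord_field A c k))"
    unfolding cov_deriv_along_def Let_def c[symmetric] dV V0 ..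
  \<comment> \<open>The terms are regrouped by \<open>i\<close>: the factor of \<open>f' i\<close>
    is the coordinate expansion of \<open>Y i\<close>, and the factor of \<open>f i t\<close> is
    that of its covariant derivative.\<close>
  also have "\<dots> = (\<Sum>k\<in>UNIV. \<Sum>i\<in>UNIV. f' i *\<^sub>R (y i k ?p *\<^sub>R coord_field A c k ?p) +
      f i t *\<^sub>R (dir_deriv A ?p ?T (y i k) *\<^sub>R coord_field A c k ?p +
        y i k ?p *\<^sub>R nabla ?p ?T (coord_field A c k)))"
    by (simp add: scaleR_sum_left sum.distrib[symmetric] algebra_simps)
  also have "\<dots> = (\<Sum>i\<in>UNIV. f' i *\<^sub>R (\<Sum>k\<in>UNIV. y i k ?p *\<^sub>R coord_field A c k ?p) +
      f i t *\<^sub>R (\<Sum>k\<in>UNIV. dir_deriv A ?p ?T (y i k) *\<^sub>R coord_field A c k ?p +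
        y i k ?p *\<^sub>R nabla ?p ?T (coord_field A c k)))"
    by (subst sum.swap) (simp only: scaleR_sum_right sum.distrib[symmetric])
  also have "\<dots> = (\<Sum>i\<in>UNIV. f' i *\<^sub>R Y i ?p + f i t *\<^sub>R nabla ?p ?T (Y i))"
  proof (intro sum.cong refl)
    fix i
    have "Y i ?p \<in> tangent_space A ?p"
      using Y cA by (auto simp: smooth_vector_field_def)
    then show "f' i *\<^sub>R (\<Sum>k\<in>UNIV. y i k ?p *\<^sub>R coord_field A c k ?p) +
      f i t *\<^sub>R (\<Sum>k\<in>UNIV. dir_deriv A ?p ?T (y i k) *\<^sub>R coord_field A c k ?p +
        y i k ?p *\<^sub>R nabla ?p ?T (coord_field A c k)) =
      f' i *\<^sub>R Y i ?p + f i t *\<^sub>R nabla ?p ?T (Y i)"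
      using tangent_expansion[OF cA, of "Y i ?p"] nabla_coordinates[OF cA T Y, of i]
      by (simp add: y_def[abs_def])
  qed
  finally show ?thesis .
qed

lemma cov_deriv_along_tangent:
  assumes "t \<in> I"
  shows "D V t \<in> tangent_space A (C t)"
proof -
  have c: "chart_at A (C t) \<in> A" "C t \<in> fst (chart_at A (C t))"
    using chart_at curve_in_topspace[OF assms] by auto
  then show ?thesis
    unfolding cov_deriv_along_def Let_def
    using velocity_tangent[OF assms] coord_field_smooth[OF c(1)]
    by (intro subspace_sum subspace_add subspace_scale tangent_space_subspace coord_field_tangent
        nabla_tangent[OF c(2)])
qed

lemma cov_deriv_along_add:
  assumes "smooth_field_along A I C V" "smooth_field_along A I C W" "t \<in> I"
  shows "D (\<lambda>s. V s + W s) t = D V t + D W t"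
proof -
  have c: "chart_at A (C t) \<in> A" "C t \<in> fst (chart_at A (C t))"
    using chart_at curve_in_topspace[OF assms(3)] by auto
  have "vector_derivative (\<lambda>s. comp (V s + W s) (chart_at A (C t)) $ i) (at t) =
      vector_derivative (\<lambda>s. comp (V s) (chart_at A (C t)) $ i) (at t) +
      vector_derivative (\<lambda>s. comp (W s) (chart_at A (C t)) $ i) (at t)" for i
    using has_vector_derivative_add[OF smooth_field_along_component[OF assms(1) c(1) assms(3) c(2)]
        smooth_field_along_component[OF assms(2) c(1) assms(3) c(2)]]
    by (simp add: vector_derivative_at)
  then show ?thesis
    by (simp add: cov_deriv_along_def Let_def sum.distrib[symmetric] algebra_simps)
qed

lemma cov_deriv_along_scale:
  assumes "smooth_field_along A I C V" "t \<in> I"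
  shows "D (\<lambda>s. r *\<^sub>R V s) t = r *\<^sub>R D V t"
proof -
  have c: "chart_at A (C t) \<in> A" "C t \<in> fst (chart_at A (C t))"
    using chart_at curve_in_topspace[OF assms(2)] by auto
  have "vector_derivative (\<lambda>s. comp (r *\<^sub>R V s) (chart_at A (C t)) $ i) (at t) =
      r * vector_derivative (\<lambda>s. comp (V s) (chart_at A (C t)) $ i) (at t)" for i
    using has_vector_derivative_mult_right[OF
        smooth_field_along_component[OF assms(1) c(1) assms(2) c(2)], of r]
    by (simp add: vector_derivative_at)
  then show ?thesis
    by (simp add: cov_deriv_along_def Let_def scaleR_sum_right algebra_simps)
qed

end

section \<open>The almost contact B-metric structure\<close>

locale F4_curve = connection_curve X A I C nabla
  for X :: "'a topology" and A :: "'a chart set" and I C nabla +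
  fixes \<phi> :: "'a \<Rightarrow> 'a tangent \<Rightarrow> 'a tangent" and \<xi> :: "'a \<Rightarrow> 'a tangent"
    and \<eta> :: "'a \<Rightarrow> 'a tangent \<Rightarrow> real" and g :: "'a \<Rightarrow> 'a tangent \<Rightarrow> 'a tangent \<Rightarrow> real"
  assumes F4: "F4_manifold X A \<phi> \<xi> \<eta> g nabla"
begin

lemma F4_structure:
  shows endomorphism: "smooth_endomorphism_field X A \<phi>"
    and xi_smooth: "smooth_vector_field X A (topspace X) \<xi>"
    and one_form: "smooth_one_form X A \<eta>"
    and metric: "semi_riemannian_metric X A g"
    and levi_civita: "levi_civita X A g nabla"
  using F4 unfolding F4_manifold_def almost_contact_B_metric_manifold_def by blast+

lemma F4_identity:
  assumes "smooth_vector_field X A U V" "smooth_vector_field X A U Y" "smooth_vector_field X A U Z"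
    and "p \<in> U"
  shows "g p (nabla p (V p) (\<lambda>q. \<phi> q (Y q)) - \<phi> p (nabla p (V p) Y)) (Z p) =
    - (lee_form X A \<phi> g nabla \<xi> p / 2) *
      (g p (\<phi> p (V p)) (\<phi> p (Y p)) * \<eta> p (Z p) + g p (\<phi> p (V p)) (\<phi> p (Z p)) * \<eta> p (Y p))"
proof -
  note F = F4[unfolded F4_manifold_def, THEN conjunct2, THEN conjunct2, THEN spec[of _ U],
      THEN spec[of _ V], THEN spec[of _ Y], THEN spec[of _ Z], THEN mp, THEN bspec[of _ _ p]]
  show ?thesis
    unfolding fundamental_F_def[symmetric] by (rule F) (use assms in auto)
qed

lemma phi_smooth:
  "smooth_vector_field X A U Y \<Longrightarrow> smooth_vector_field X A U (\<lambda>q. \<phi> q (Y q))"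
  using endomorphism[unfolded smooth_endomorphism_field_def, THEN conjunct2, THEN conjunct2] by blast

lemma metric_smooth:
  "smooth_vector_field X A U Y \<Longrightarrow> smooth_vector_field X A U Z \<Longrightarrow>
     smooth_function X A U (\<lambda>p. g p (Y p) (Z p))"
  using metric[unfolded semi_riemannian_metric_def, THEN conjunct2, THEN conjunct2, THEN conjunct2] by blast

lemma nabla_metric:
  assumes "smooth_vector_field X A U Y" "smooth_vector_field X A U Z" "p \<in> U"
    and "v \<in> tangent_space A p"
  shows "dir_deriv A p v (\<lambda>q. g q (Y q) (Z q)) = g p (nabla p v Y) (Z p) + g p (Y p) (nabla p v Z)"
  using levi_civita[unfolded levi_civita_def, THEN conjunct2, THEN spec[of _ U], THEN spec[of _ Y],
      THEN spec[of _ Z]] assms by blast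

context
  fixes p
  assumes p: "p \<in> topspace X"
begin

lemma metric_lin:
  assumes "u \<in> tangent_space A p" "v \<in> tangent_space A p" "w \<in> tangent_space A p"
  shows "g p (r *\<^sub>R v + s *\<^sub>R w) u = r * g p v u + s * g p w u"
  using metric[unfolded semi_riemannian_metric_def, THEN conjunct1] p assms by blast

lemma metric_sym:
  assumes "v \<in> tangent_space A p" "w \<in> tangent_space A p"
  shows "g p v w = g p w v"
  using metric[unfolded semi_riemannian_metric_def, THEN conjunct2, THEN conjunct1] p assms by blast

lemma metric_nondegenerate:
  assumes "v \<in> tangent_space A p" "\<And>w. w \<in> tangent_space A p \<Longrightarrow> g p v w = 0"
  shows "v = 0"
  using metric[unfolded semi_riemannian_metric_def, THEN conjunct2, THEN conjunct2, THEN conjunct1] p assms by blast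

lemma phi_tangent: "v \<in> tangent_space A p \<Longrightarrow> \<phi> p v \<in> tangent_space A p"
  using endomorphism[unfolded smooth_endomorphism_field_def, THEN conjunct1] p by blast

lemma phi_lin:
  assumes "v \<in> tangent_space A p" "w \<in> tangent_space A p"
  shows "\<phi> p (r *\<^sub>R v + s *\<^sub>R w) = r *\<^sub>R \<phi> p v + s *\<^sub>R \<phi> p w"
  using endomorphism[unfolded smooth_endomorphism_field_def, THEN conjunct2, THEN conjunct1] p assms by blast

lemma eta_lin:
  assumes "v \<in> tangent_space A p" "w \<in> tangent_space A p"
  shows "\<eta> p (r *\<^sub>R v + s *\<^sub>R w) = r * \<eta> p v + s * \<eta> p w"
  using one_form[unfolded smooth_one_form_def, THEN conjunct1] p assms by blast

lemma xi_tangent: "\<xi> p \<in> tangent_space A p"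
  using xi_smooth p unfolding smooth_vector_field_def by blast

lemma B_metric_rules:
  shows eta_xi: "\<eta> p (\<xi> p) = 1"
    and phi_phi: "v \<in> tangent_space A p \<Longrightarrow> \<phi> p (\<phi> p v) = - v + \<eta> p v *\<^sub>R \<xi> p"
    and metric_phi_phi: "v \<in> tangent_space A p \<Longrightarrow> w \<in> tangent_space A p \<Longrightarrow>
      g p (\<phi> p v) (\<phi> p w) = - g p v w + \<eta> p v * \<eta> p w"
  using F4 p unfolding F4_manifold_def almost_contact_B_metric_manifold_def by blast+

lemma tangent_closed:
  shows "0 \<in> tangent_space A p"
    and "v \<in> tangent_space A p \<Longrightarrow> w \<in> tangent_space A p \<Longrightarrow> v + w \<in> tangent_space A p"
    and "v \<in> tangent_space A p \<Longrightarrow> w \<in> tangent_space A p \<Longrightarrow> v - w \<in> tangent_space A p"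
    and "v \<in> tangent_space A p \<Longrightarrow> - v \<in> tangent_space A p"
    and "v \<in> tangent_space A p \<Longrightarrow> r *\<^sub>R v \<in> tangent_space A p"
  using tangent_space_subspace
  by (auto intro: subspace_0 subspace_add subspace_diff subspace_neg subspace_scale)

lemma metric_left:
  assumes "v \<in> tangent_space A p" "w \<in> tangent_space A p" "u \<in> tangent_space A p"
  shows "g p (v + w) u = g p v u + g p w u" "g p (v - w) u = g p v u - g p w u"
    "g p (- v) u = - g p v u" "g p (r *\<^sub>R v) u = r * g p v u" "g p 0 u = 0"
  using metric_lin[OF assms(3,1,2), of 1 1] metric_lin[OF assms(3,1,2), of 1 "-1"]
    metric_lin[OF assms(3,1,1), of "-1" 0] metric_lin[OF assms(3,1,1), of r 0]
    metric_lin[OF assms(3,1,1), of 0 0] by auto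

lemma metric_right:
  assumes "v \<in> tangent_space A p" "w \<in> tangent_space A p" "u \<in> tangent_space A p"
  shows "g p u (v + w) = g p u v + g p u w" "g p u (v - w) = g p u v - g p u w"
    "g p u (- v) = - g p u v" "g p u (r *\<^sub>R v) = r * g p u v" "g p u 0 = 0"
  using metric_left[OF assms] assms by (simp_all add: metric_sym[of u] tangent_closed)

lemma phi_rules:
  assumes "v \<in> tangent_space A p" "w \<in> tangent_space A p"
  shows "\<phi> p (v + w) = \<phi> p v + \<phi> p w" "\<phi> p (v - w) = \<phi> p v - \<phi> p w"
    "\<phi> p (- v) = - \<phi> p v" "\<phi> p (r *\<^sub>R v) = r *\<^sub>R \<phi> p v" "\<phi> p 0 = 0"
  using phi_lin[OF assms, of 1 1] phi_lin[OF assms, of 1 "-1"]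
    phi_lin[OF assms(1,1), of "-1" 0] phi_lin[OF assms(1,1), of r 0]
    phi_lin[OF assms(1,1), of 0 0] by auto

lemma eta_rules:
  assumes "v \<in> tangent_space A p" "w \<in> tangent_space A p"
  shows "\<eta> p (v + w) = \<eta> p v + \<eta> p w" "\<eta> p (v - w) = \<eta> p v - \<eta> p w"
    "\<eta> p (- v) = - \<eta> p v" "\<eta> p (r *\<^sub>R v) = r * \<eta> p v" "\<eta> p 0 = 0"
  using eta_lin[OF assms, of 1 1] eta_lin[OF assms, of 1 "-1"]
    eta_lin[OF assms(1,1), of "-1" 0] eta_lin[OF assms(1,1), of r 0]
    eta_lin[OF assms(1,1), of 0 0] by auto

lemma xi_nonzero: "\<xi> p \<noteq> 0"
  using eta_xi eta_rules(5)[OF xi_tangent xi_tangent] by auto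

text \<open>Since \<open>\<phi> (\<phi> \<xi>) = 0\<close>, the formula for the square of
  \<open>\<phi>\<close>, applied to \<open>\<phi> \<xi>\<close>, makes \<open>\<phi> \<xi>\<close> a
  multiple \<open>r \<xi>\<close>. Applying \<open>\<phi>\<close> again gives
  \<open>r * r = 0\<close>.\<close>

lemma phi_xi: "\<phi> p (\<xi> p) = 0"
proof -
  note x = xi_tangent and fx = phi_tangent[OF xi_tangent]
  define r where "r = \<eta> p (\<phi> p (\<xi> p))"
  have 2: "\<phi> p (\<phi> p (\<xi> p)) = 0"
    using phi_phi[OF x] by (simp add: eta_xi)
  then have "- \<phi> p (\<xi> p) + r *\<^sub>R \<xi> p = 0"
    using phi_phi[OF fx] phi_rules(5)[OF x x] by (simp add: r_def)
  then have eq: "\<phi> p (\<xi> p) = r *\<^sub>R \<xi> p"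
    by (simp add: add_eq_0_iff2)
  then have "(r * r) *\<^sub>R \<xi> p = 0"
    using 2 phi_rules(4)[OF x x, of r] by (simp add: eq)
  then show ?thesis
    using xi_nonzero eq by auto
qed

text \<open>The third power of \<open>\<phi>\<close> is evaluated in two ways, bracketing on the
  inside or on the outside; the results differ by \<open>\<eta> (\<phi> v) \<xi>\<close>.\<close>

lemma eta_phi:
  assumes "v \<in> tangent_space A p"
  shows "\<eta> p (\<phi> p v) = 0"
proof -
  have "\<phi> p (\<phi> p (\<phi> p v)) = - \<phi> p v"
    using assms
    by (simp add: phi_phi phi_rules phi_xi tangent_closed xi_tangent)
  then have "\<eta> p (\<phi> p v) *\<^sub>R \<xi> p = 0"
    using phi_phi[OF phi_tangent[OF assms]] by simp
  then show ?thesis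
    using xi_nonzero by simp
qed

text \<open>Taking \<open>w = \<xi>\<close> in the B-metric identity makes the left-hand side
  vanish.\<close>

lemma metric_xi:
  assumes "v \<in> tangent_space A p"
  shows "g p v (\<xi> p) = \<eta> p v"
  using metric_phi_phi[OF assms xi_tangent] assms
  by (simp add: phi_xi eta_xi metric_right[OF assms assms] phi_tangent
      metric_right(5)[of v v "\<phi> p v"])

lemma metric_xi_left: "v \<in> tangent_space A p \<Longrightarrow> g p (\<xi> p) v = \<eta> p v"
  by (simp add: metric_xi metric_sym[OF xi_tangent])

text \<open>The B-metric identity is applied to \<open>\<phi> v\<close> and \<open>w\<close>; the
  terms with \<open>\<eta>\<close> drop out. Symmetry of \<open>\<phi>\<close>, instead of the
  skewness found for almost contact metric structures, is what allows a nonzero constant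
  \<open>b\<close>.\<close>

lemma phi_self_adjoint:
  assumes "v \<in> tangent_space A p" "w \<in> tangent_space A p"
  shows "g p (\<phi> p v) w = g p v (\<phi> p w)"
  using metric_phi_phi[OF phi_tangent[OF assms(1)] assms(2)] assms
  by (simp add: phi_phi eta_phi metric_left metric_xi_left tangent_closed xi_tangent phi_tangent)

end


section \<open>Derivatives of the structure tensors along the curve\<close>

text \<open>With both fields expanded in coordinate fields, compatibility of \<open>nabla\<close>
  with \<open>g\<close> applies to the functions \<open>g(e_i, e_j)\<close>, and the coefficients
  are differentiated by the product rule.\<close>

lemma cov_deriv_along_metric:
  assumes V: "smooth_field_along A I C V" and W: "smooth_field_along A I C W" and t: "t \<in> I"
  shows "((\<lambda>s. g (C s) (V s) (W s)) has_vector_derivative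
      g (C t) (D V t) (W t) + g (C t) (V t) (D W t)) (at t)"
proof -
  let ?p = "C t" and ?T = "velocity A C t"
  define c where "c = chart_at A ?p"
  have c: "c \<in> A" "?p \<in> fst c"
    using chart_at curve_in_topspace[OF t] unfolding c_def by auto
  note p = curve_in_topspace[OF t] and T = velocity_tangent[OF t]
  define e where "e = coord_field A c"
  have e: "smooth_vector_field X A (fst c) (e i)" for i
    unfolding e_def by (rule coord_field_smooth[OF c(1)])
  have et: "e i q \<in> tangent_space A q" if "q \<in> fst c" for i q
    using that e by (auto simp: smooth_vector_field_def)
  have ne: "nabla ?p ?T (e i) \<in> tangent_space A ?p" for i
    by (rule nabla_tangent[OF c(2) T e])
  define dV where "dV i = vector_derivative (\<lambda>s. comp (V s) c $ i) (at t)" for i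
  define dW where "dW i = vector_derivative (\<lambda>s. comp (W s) c $ i) (at t)" for i
  have dV: "((\<lambda>s. comp (V s) c $ i) has_vector_derivative dV i) (at t)" for i
    unfolding dV_def by (rule smooth_field_along_component[OF V c(1) t c(2)])
  have dW: "((\<lambda>s. comp (W s) c $ i) has_vector_derivative dW i) (at t)" for i
    unfolding dW_def by (rule smooth_field_along_component[OF W c(1) t c(2)])
  have left: "g q (\<Sum>i\<in>UNIV. r i *\<^sub>R v i) u = (\<Sum>i\<in>UNIV. r i * g q (v i) u)"
    if "q \<in> fst c" "\<And>i. v i \<in> tangent_space A q" "u \<in> tangent_space A q"
    for q u and r :: "3 \<Rightarrow> real" and v
    using linear_on_sum[OF tangent_space_subspace[of q], of UNIV "\<lambda>v. g q v u" v r]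
      metric_lin[OF subsetD[OF chart_subset[OF c(1)] that(1)] that(3)] that(2) by simp
  have right: "g q u (\<Sum>i\<in>UNIV. r i *\<^sub>R v i) = (\<Sum>i\<in>UNIV. r i * g q u (v i))"
    if "q \<in> fst c" "\<And>i. v i \<in> tangent_space A q" "u \<in> tangent_space A q"
    for q u and r :: "3 \<Rightarrow> real" and v
  proof -
    note q = subsetD[OF chart_subset[OF c(1)] that(1)]
    have "(\<Sum>i\<in>UNIV. r i *\<^sub>R v i) \<in> tangent_space A q"
      using that by (intro subspace_sum subspace_scale tangent_space_subspace) auto
    then show ?thesis
      using left[OF that(1), of v u r, OF that(2,3)] metric_sym[OF q that(3)] that(2) by simp
  qed
  have expand: "g (C s) (V s) (W s) =
      (\<Sum>i\<in>UNIV. \<Sum>j\<in>UNIV. (comp (V s) c $ i * comp (W s) c $ j) * g (C s) (e i (C s)) (e j (C s)))"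
    if s: "s \<in> I" "C s \<in> fst c" for s
  proof -
    note Vs = smooth_field_along_tangent[OF V s(1)] and Ws = smooth_field_along_tangent[OF W s(1)]
    have "g (C s) (V s) (W s) = g (C s) (\<Sum>i\<in>UNIV. comp (V s) c $ i *\<^sub>R e i (C s)) (W s)"
      using tangent_expansion[OF c(1) s(2) Vs] unfolding e_def by simp
    also have "\<dots> = (\<Sum>i\<in>UNIV. comp (V s) c $ i * g (C s) (e i (C s)) (W s))"
      by (rule left[OF s(2) et[OF s(2)] Ws])
    also have "\<dots> = (\<Sum>i\<in>UNIV. comp (V s) c $ i *
        g (C s) (e i (C s)) (\<Sum>j\<in>UNIV. comp (W s) c $ j *\<^sub>R e j (C s)))"
      using tangent_expansion[OF c(1) s(2) Ws] unfolding e_def by simp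
    also have "\<dots> = (\<Sum>i\<in>UNIV. comp (V s) c $ i *
        (\<Sum>j\<in>UNIV. comp (W s) c $ j * g (C s) (e i (C s)) (e j (C s))))"
      by (simp only: right[OF s(2) et[OF s(2)] et[OF s(2)]])
    finally show ?thesis
      by (simp add: sum_distrib_left mult.assoc)
  qed
  have "((\<lambda>s. g (C s) (e i (C s)) (e j (C s))) has_vector_derivative
      g ?p (nabla ?p ?T (e i)) (e j ?p) + g ?p (e i ?p) (nabla ?p ?T (e j))) (at t)" for i j
    using curve_chain_rule[OF metric_smooth[OF e e] t c(2)] nabla_metric[OF e e c(2) T] by simp
  then have "((\<lambda>s. \<Sum>i\<in>UNIV. \<Sum>j\<in>UNIV.
        (comp (V s) c $ i * comp (W s) c $ j) * g (C s) (e i (C s)) (e j (C s)))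
      has_vector_derivative (\<Sum>i\<in>UNIV. \<Sum>j\<in>UNIV.
        (comp (V t) c $ i * comp (W t) c $ j) *
          (g ?p (nabla ?p ?T (e i)) (e j ?p) + g ?p (e i ?p) (nabla ?p ?T (e j)))
        + (comp (V t) c $ i * dW j + dV i * comp (W t) c $ j) * g ?p (e i ?p) (e j ?p))) (at t)"
    by (intro has_vector_derivative_sum has_vector_derivative_mult dV dW)
  then have deriv: "((\<lambda>s. g (C s) (V s) (W s))
      has_vector_derivative (\<Sum>i\<in>UNIV. \<Sum>j\<in>UNIV.
        (comp (V t) c $ i * comp (W t) c $ j) *
          (g ?p (nabla ?p ?T (e i)) (e j ?p) + g ?p (e i ?p) (nabla ?p ?T (e j)))
        + (comp (V t) c $ i * dW j + dV i * comp (W t) c $ j) * g ?p (e i ?p) (e j ?p))) (at t)"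
    by (rule has_vector_derivative_transform_within_open[OF _ curve_preimage_open[OF chart_openin]])
      (use c t expand in auto)
  note Vt = smooth_field_along_tangent[OF V t] and Wt = smooth_field_along_tangent[OF W t]
  have mem: "(\<Sum>i\<in>UNIV. r i *\<^sub>R e i ?p) \<in> tangent_space A ?p"
      "(\<Sum>i\<in>UNIV. r i *\<^sub>R nabla ?p ?T (e i)) \<in> tangent_space A ?p" for r :: "3 \<Rightarrow> real"
    using et[OF c(2)] ne by (intro subspace_sum subspace_scale tangent_space_subspace, simp)+
  have DV: "D V t = (\<Sum>i\<in>UNIV. dV i *\<^sub>R e i ?p) + (\<Sum>i\<in>UNIV. comp (V t) c $ i *\<^sub>R nabla ?p ?T (e i))"
    and DW: "D W t = (\<Sum>i\<in>UNIV. dW i *\<^sub>R e i ?p) + (\<Sum>i\<in>UNIV. comp (W t) c $ i *\<^sub>R nabla ?p ?T (e i))"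
    unfolding cov_deriv_along_def Let_def c_def[symmetric] dV_def dW_def e_def
    by (simp_all add: sum.distrib)
  have V0: "V t = (\<Sum>i\<in>UNIV. comp (V t) c $ i *\<^sub>R e i ?p)"
    and W0: "W t = (\<Sum>i\<in>UNIV. comp (W t) c $ i *\<^sub>R e i ?p)"
    unfolding e_def using tangent_expansion[OF c] Vt Wt by auto
  have "g ?p u (W t) = (\<Sum>j\<in>UNIV. comp (W t) c $ j * g ?p u (e j ?p))"
    if "u \<in> tangent_space A ?p" for u
    by (subst W0) (rule right[OF c(2) et[OF c(2)] that])
  note uW = this[OF et[OF c(2)]] this[OF ne]
  have "g ?p (D V t) (W t) = (\<Sum>i\<in>UNIV. dV i * g ?p (e i ?p) (W t)) +
      (\<Sum>i\<in>UNIV. comp (V t) c $ i * g ?p (nabla ?p ?T (e i)) (W t))"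
    unfolding DV metric_left(1)[OF p mem Wt] left[OF c(2) et[OF c(2)] Wt] left[OF c(2) ne Wt] ..
  then have gDV: "g ?p (D V t) (W t) = (\<Sum>i\<in>UNIV. \<Sum>j\<in>UNIV.
      dV i * (comp (W t) c $ j * g ?p (e i ?p) (e j ?p)) +
      comp (V t) c $ i * (comp (W t) c $ j * g ?p (nabla ?p ?T (e i)) (e j ?p)))"
    unfolding uW by (simp add: sum_distrib_left sum.distrib)
  have uDW: "g ?p u (D W t) = (\<Sum>j\<in>UNIV. dW j * g ?p u (e j ?p)) +
      (\<Sum>j\<in>UNIV. comp (W t) c $ j * g ?p u (nabla ?p ?T (e j)))"
    if "u \<in> tangent_space A ?p" for u
    unfolding DW metric_right(1)[OF p mem that] right[OF c(2) et[OF c(2)] that]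
      right[OF c(2) ne that] ..
  have "g ?p (V t) (D W t) = (\<Sum>i\<in>UNIV. comp (V t) c $ i * g ?p (e i ?p) (D W t))"
    by (subst V0) (rule left[OF c(2) et[OF c(2)] cov_deriv_along_tangent[OF t]])
  then have gDW: "g ?p (V t) (D W t) = (\<Sum>i\<in>UNIV. \<Sum>j\<in>UNIV.
      dW j * (comp (V t) c $ i * g ?p (e i ?p) (e j ?p)) +
      comp (W t) c $ j * (comp (V t) c $ i * g ?p (e i ?p) (nabla ?p ?T (e j))))"
    unfolding uDW[OF et[OF c(2)]]
    by (simp add: sum_distrib_left sum.distrib distrib_left mult.left_commute)
  show ?thesis
    using deriv unfolding gDV gDW sum.distrib[symmetric] by (simp add: algebra_simps)
qed

lemma phi_expansion:
  assumes "c \<in> A" "q \<in> fst c" "v \<in> tangent_space A q"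
  shows "\<phi> q v = (\<Sum>i\<in>UNIV. (comp v c $ i) *\<^sub>R \<phi> q (coord_field A c i q))"
proof -
  have q: "q \<in> topspace X"
    using assms chart_subset by blast
  have "\<phi> q v = \<phi> q (\<Sum>i\<in>UNIV. (comp v c $ i) *\<^sub>R coord_field A c i q)"
    using tangent_expansion[OF assms] by simp
  also have "\<dots> = (\<Sum>i\<in>UNIV. (comp v c $ i) *\<^sub>R \<phi> q (coord_field A c i q))"
    using phi_lin[OF q] coord_field_tangent[OF assms(1,2)]
    by (intro linear_on_sum[OF tangent_space_subspace[of q]]) auto
  finally show ?thesis .
qed

text \<open>Smoothness of \<open>\<phi>\<close> is a statement about vector fields, so it enters
  through the images of the coordinate fields, restricted to the curve.\<close>

lemma smooth_field_along_phi:
  assumes "smooth_field_along A I C V"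
  shows "smooth_field_along A I C (\<lambda>t. \<phi> (C t) (V t))"
  unfolding smooth_field_along_def
proof (intro conjI ballI)
  show "\<phi> (C t) (V t) \<in> tangent_space A (C t)" if "t \<in> I" for t
    using that assms by (intro phi_tangent curve_in_topspace smooth_field_along_tangent)
  fix c assume c: "c \<in> A"
  let ?S = "{t\<in>I. C t \<in> fst c}"
  have S: "open ?S"
    using c by (intro curve_preimage_open chart_openin)
  have "smooth_on ?S (\<lambda>t. comp (V t) c)"
    using assms c by (simp add: smooth_field_along_def)
  moreover have "smooth_on ?S (\<lambda>t. comp (\<phi> (C t) (coord_field A c i (C t))) c)" for i
    using vector_field_along[OF phi_smooth[OF coord_field_smooth[OF c]] c, of i] by simp
  ultimately have "smooth_on ?S
      (\<lambda>t. \<Sum>i\<in>UNIV. (comp (V t) c $ i) *\<^sub>R comp (\<phi> (C t) (coord_field A c i (C t))) c)"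
    by (intro smooth_on_sum smooth_on_scaleR smooth_on_vec_nth S)
  then show "smooth_on ?S (\<lambda>t. comp (\<phi> (C t) (V t)) c)"
  proof (rule smooth_on_transform[OF S])
    fix t assume "t \<in> ?S"
    then have "\<phi> (C t) (V t) = (\<Sum>i\<in>UNIV. (comp (V t) c $ i) *\<^sub>R \<phi> (C t) (coord_field A c i (C t)))"
      using assms c by (intro phi_expansion smooth_field_along_tangent) auto
    then show "(\<Sum>i\<in>UNIV. (comp (V t) c $ i) *\<^sub>R comp (\<phi> (C t) (coord_field A c i (C t))) c) =
        comp (\<phi> (C t) (V t)) c"
      by (simp add: comp_sum)
  qed
qed

text \<open>The product rule for \<open>\<phi> V\<close>, with the covariant derivative of
  \<open>\<phi>\<close> replaced by its \<open>F4\<close> expression. The correction is tensorial,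
  so the identity for vector fields determines it at a point; pairing with \<open>z\<close> matches
  the three-argument form of \<open>F\<close>.\<close>

lemma cov_deriv_along_phi:
  assumes V: "smooth_field_along A I C V" and t: "t \<in> I" and z: "z \<in> tangent_space A (C t)"
  shows "g (C t) (D (\<lambda>s. \<phi> (C s) (V s)) t) z = g (C t) (\<phi> (C t) (D V t)) z
    - lee_form X A \<phi> g nabla \<xi> (C t) / 2 *
      (g (C t) (\<phi> (C t) (velocity A C t)) (\<phi> (C t) (V t)) * \<eta> (C t) z +
       g (C t) (\<phi> (C t) (velocity A C t)) (\<phi> (C t) z) * \<eta> (C t) (V t))"
proof -
  let ?p = "C t" and ?T = "velocity A C t" and ?\<theta> = "lee_form X A \<phi> g nabla \<xi> (C t)"
  define c where "c = chart_at A ?p"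
  have c: "c \<in> A" "?p \<in> fst c"
    using chart_at curve_in_topspace[OF t] unfolding c_def by auto
  note p = curve_in_topspace[OF t] and T = velocity_tangent[OF t]
    and Vt = smooth_field_along_tangent[OF V t]
  define e where "e = coord_field A c"
  have e: "smooth_vector_field X A (fst c) (e i)" for i
    unfolding e_def by (rule coord_field_smooth[OF c(1)])
  have et: "e i ?p \<in> tangent_space A ?p" for i
    using c e by (auto simp: smooth_vector_field_def)
  have ne: "nabla ?p ?T (e i) \<in> tangent_space A ?p" for i
    by (rule nabla_tangent[OF c(2) T e])
  have nfe: "nabla ?p ?T (\<lambda>q. \<phi> q (e i q)) \<in> tangent_space A ?p" for i
    by (rule nabla_tangent[OF c(2) T phi_smooth[OF e]])
  define dV where "dV i = vector_derivative (\<lambda>s. comp (V s) c $ i) (at t)" for i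
  \<comment> \<open>\<open>B i\<close> is the covariant derivative of \<open>\<phi>\<close> in
    direction \<open>T\<close>, evaluated on \<open>e i\<close>. The terms with \<open>dV\<close>
    cancel between \<open>D (\<phi> V)\<close> and \<open>\<phi> (D V)\<close>, and only the
    \<open>B i\<close> survive.\<close>
  define B where "B i = nabla ?p ?T (\<lambda>q. \<phi> q (e i q)) - \<phi> ?p (nabla ?p ?T (e i))" for i
  have B: "B i \<in> tangent_space A ?p" for i
    unfolding B_def using nfe ne p by (intro tangent_closed phi_tangent)
  have gB: "g ?p (B i) z = - (?\<theta> / 2) *
      (g ?p (\<phi> ?p ?T) (\<phi> ?p (e i ?p)) * \<eta> ?p z + g ?p (\<phi> ?p ?T) (\<phi> ?p z) * \<eta> ?p (e i ?p))" for i
  proof -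
    obtain Y where Y: "smooth_vector_field X A (fst c) Y" "Y ?p = ?T"
      using tangent_extension[OF c T] .
    obtain Z where Z: "smooth_vector_field X A (fst c) Z" "Z ?p = z"
      using tangent_extension[OF c z] .
    show ?thesis
      using F4_identity[OF Y(1) e Z(1) c(2)] unfolding Y Z B_def .
  qed
  have "D (\<lambda>s. \<phi> (C s) (V s)) t = (\<Sum>i\<in>UNIV. dV i *\<^sub>R \<phi> ?p (e i ?p) +
      comp (V t) c $ i *\<^sub>R nabla ?p ?T (\<lambda>q. \<phi> q (e i q)))"
  proof (rule cov_deriv_along_combination[OF t c_def phi_smooth[OF e]])
    show "((\<lambda>s. comp (V s) c $ i) has_vector_derivative dV i) (at t)" for i
      unfolding dV_def by (rule smooth_field_along_component[OF V c(1) t c(2)])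
    show "\<phi> (C s) (V s) = (\<Sum>i\<in>UNIV. comp (V s) c $ i *\<^sub>R \<phi> (C s) (e i (C s)))"
      if "s \<in> I" "C s \<in> fst c" for s
      unfolding e_def using that V c by (intro phi_expansion smooth_field_along_tangent)
  qed
  moreover have "\<phi> ?p (D V t) = (\<Sum>i\<in>UNIV. dV i *\<^sub>R \<phi> ?p (e i ?p) +
      comp (V t) c $ i *\<^sub>R \<phi> ?p (nabla ?p ?T (e i)))"
  proof -
    have phi_sum: "\<phi> ?p (\<Sum>i\<in>UNIV. r i *\<^sub>R v i) = (\<Sum>i\<in>UNIV. r i *\<^sub>R \<phi> ?p (v i))"
      if "\<And>i. v i \<in> tangent_space A ?p" for r :: "3 \<Rightarrow> real" and v
      using phi_lin[OF p] that by (intro linear_on_sum[OF tangent_space_subspace[of ?p]]) auto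
    have "D V t = (\<Sum>i\<in>UNIV. dV i *\<^sub>R e i ?p) + (\<Sum>i\<in>UNIV. comp (V t) c $ i *\<^sub>R nabla ?p ?T (e i))"
      unfolding cov_deriv_along_def Let_def c_def[symmetric] dV_def e_def by (simp add: sum.distrib)
    also have "\<phi> ?p \<dots> = \<phi> ?p (\<Sum>i\<in>UNIV. dV i *\<^sub>R e i ?p) +
        \<phi> ?p (\<Sum>i\<in>UNIV. comp (V t) c $ i *\<^sub>R nabla ?p ?T (e i))"
      using et ne by (intro phi_rules p subspace_sum subspace_scale tangent_space_subspace) auto
    finally show ?thesis
      by (simp add: phi_sum et ne sum.distrib)
  qed
  ultimately have "D (\<lambda>s. \<phi> (C s) (V s)) t = \<phi> ?p (D V t) + (\<Sum>i\<in>UNIV. comp (V t) c $ i *\<^sub>R B i)"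
    by (simp add: B_def sum.distrib[symmetric] algebra_simps)
  then have "g ?p (D (\<lambda>s. \<phi> (C s) (V s)) t) z =
      g ?p (\<phi> ?p (D V t)) z + g ?p (\<Sum>i\<in>UNIV. comp (V t) c $ i *\<^sub>R B i) z"
    using cov_deriv_along_tangent[OF t] z B
    by (simp add: metric_left p phi_tangent subspace_sum subspace_scale tangent_space_subspace)
  also have "g ?p (\<Sum>i\<in>UNIV. comp (V t) c $ i *\<^sub>R B i) z = (\<Sum>i\<in>UNIV. comp (V t) c $ i * g ?p (B i) z)"
    using linear_on_sum[OF tangent_space_subspace[of ?p], of UNIV "\<lambda>v. g ?p v z" B]
      metric_lin[OF p z] B by simp
  also have "\<dots> = - (?\<theta> / 2) * (
      (\<Sum>i\<in>UNIV. comp (V t) c $ i * g ?p (\<phi> ?p ?T) (\<phi> ?p (e i ?p))) * \<eta> ?p z +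
      g ?p (\<phi> ?p ?T) (\<phi> ?p z) * (\<Sum>i\<in>UNIV. comp (V t) c $ i * \<eta> ?p (e i ?p)))"
    unfolding gB by (simp add: sum_3 algebra_simps)
  also have "(\<Sum>i\<in>UNIV. comp (V t) c $ i * \<eta> ?p (e i ?p)) = \<eta> ?p (V t)"
  proof -
    have "\<eta> ?p (V t) = \<eta> ?p (\<Sum>i\<in>UNIV. comp (V t) c $ i *\<^sub>R e i ?p)"
      unfolding e_def using tangent_expansion[OF c Vt] by simp
    also have "\<dots> = (\<Sum>i\<in>UNIV. comp (V t) c $ i *\<^sub>R \<eta> ?p (e i ?p))"
      using eta_lin[OF p] et by (intro linear_on_sum[OF tangent_space_subspace[of ?p]]) auto
    finally show ?thesis by simp
  qed
  also have "(\<Sum>i\<in>UNIV. comp (V t) c $ i * g ?p (\<phi> ?p ?T) (\<phi> ?p (e i ?p))) =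
      g ?p (\<phi> ?p ?T) (\<phi> ?p (V t))"
  proof -
    have "\<phi> ?p (V t) = (\<Sum>i\<in>UNIV. comp (V t) c $ i *\<^sub>R \<phi> ?p (e i ?p))"
      unfolding e_def by (rule phi_expansion[OF c Vt])
    then have "g ?p (\<phi> ?p (V t)) (\<phi> ?p ?T) =
        (\<Sum>i\<in>UNIV. comp (V t) c $ i *\<^sub>R g ?p (\<phi> ?p (e i ?p)) (\<phi> ?p ?T))"
      using linear_on_sum[OF tangent_space_subspace[of ?p], of UNIV "\<lambda>v. g ?p v (\<phi> ?p ?T)"
          "\<lambda>i. \<phi> ?p (e i ?p)" "\<lambda>i. comp (V t) c $ i"]
        metric_lin[OF p phi_tangent[OF p T]] phi_tangent[OF p et] by simp
    then show ?thesis
      using metric_sym[OF p phi_tangent[OF p T]] phi_tangent[OF p Vt] phi_tangent[OF p et] by simp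
  qed
  finally show ?thesis
    by simp
qed

text \<open>Written for \<open>\<phi> \<xi>\<close>, which is known to vanish only at parameters in
  \<open>I\<close>; the combination with zero coefficients makes the locality explicit.\<close>

lemma cov_deriv_along_vanishing:
  assumes "t \<in> I" "\<And>s. s \<in> I \<Longrightarrow> V s = 0"
  shows "D V t = 0"
proof -
  have c: "chart_at A (C t) \<in> A"
    using chart_at curve_in_topspace[OF assms(1)] by auto
  have "D V t = (\<Sum>i\<in>UNIV. 0 *\<^sub>R coord_field A (chart_at A (C t)) i (C t) +
      0 *\<^sub>R nabla (C t) (velocity A C t) (coord_field A (chart_at A (C t)) i))"
    using assms by (intro cov_deriv_along_combination[OF assms(1) refl coord_field_smooth[OF c],
          where f = "\<lambda>_ _. 0"]) auto
  then show ?thesis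
    by simp
qed

text \<open>Turns each constant product, from the slant condition or from a Frenet normalisation,
  into a linear equation for covariant derivatives.\<close>

lemma cov_deriv_along_metric_const:
  assumes "smooth_field_along A I C V" "smooth_field_along A I C W" "t \<in> I"
    and "\<And>s. s \<in> I \<Longrightarrow> g (C s) (V s) (W s) = r"
  shows "g (C t) (D V t) (W t) + g (C t) (V t) (D W t) = 0"
proof -
  have "((\<lambda>s. r) has_vector_derivative g (C t) (D V t) (W t) + g (C t) (V t) (D W t)) (at t)"
    by (rule has_vector_derivative_transform_within_open[OF cov_deriv_along_metric[OF assms(1-3)],
          of I]) (use assms curve in \<open>auto simp: smooth_curve_def\<close>)
  then show ?thesis
    using vector_derivative_at has_vector_derivative_const by metis
qed

text \<open>Differentiating \<open>\<phi> \<xi> = 0\<close> with the \<open>F4\<close> identity and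
  pairing with \<open>\<phi> z\<close> determines \<open>g(\<phi> (D \<xi>), \<phi> z)\<close>.
  Differentiating \<open>g(\<xi>, \<xi>) = 1\<close> gives \<open>\<eta> (D \<xi>) = 0\<close>, so
  this product is \<open>- g(D \<xi>, z)\<close>.\<close>

lemma cov_deriv_along_xi:
  assumes t: "t \<in> I" and z: "z \<in> tangent_space A (C t)"
  shows "g (C t) (D (\<lambda>s. \<xi> (C s)) t) z =
    lee_form X A \<phi> g nabla \<xi> (C t) / 2 * g (C t) (\<phi> (C t) (velocity A C t)) z"
proof -
  note p = curve_in_topspace[OF t] and T = velocity_tangent[OF t]
  note \<xi>s = smooth_field_along_vector_field[OF xi_smooth]
  let ?x = "D (\<lambda>s. \<xi> (C s)) t"
  note x = cov_deriv_along_tangent[OF t, of "\<lambda>s. \<xi> (C s)"]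
  have "g (C t) ?x (\<xi> (C t)) + g (C t) (\<xi> (C t)) ?x = 0"
    using curve_in_topspace
    by (intro cov_deriv_along_metric_const[OF \<xi>s \<xi>s t, of 1]) (simp add: metric_xi xi_tangent eta_xi)
  then have eta: "\<eta> (C t) ?x = 0"
    using x by (simp add: metric_xi metric_xi_left p)
  have "D (\<lambda>s. \<phi> (C s) (\<xi> (C s))) t = 0"
    using t curve_in_topspace by (intro cov_deriv_along_vanishing) (simp_all add: phi_xi)
  then have "0 = g (C t) (\<phi> (C t) ?x) (\<phi> (C t) z) - lee_form X A \<phi> g nabla \<xi> (C t) / 2 *
      g (C t) (\<phi> (C t) (velocity A C t)) (\<phi> (C t) (\<phi> (C t) z))"
    using cov_deriv_along_phi[OF \<xi>s t phi_tangent[OF p z]] p T z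
    by (simp add: phi_xi eta_xi metric_left metric_right[OF p z z] phi_tangent eta_phi)
  then show ?thesis
    using p T z x eta
    by (simp add: metric_phi_phi eta_phi phi_tangent phi_self_adjoint[OF p T z])
qed

end

section \<open>Slant null curves and their Frenet frames\<close>

locale slant_null_curve = F4_curve X A I C nabla \<phi> \<xi> \<eta> g
  for X :: "'a topology" and A :: "'a chart set" and I C nabla \<phi> \<xi> \<eta> g +
  fixes a b :: real
  assumes null: "null_curve A g I C" and slant: "phi_slant A \<phi> \<eta> g I C a b"
begin

abbreviation T :: "real \<Rightarrow> 'a tangent" where
  "T \<equiv> velocity A C"

abbreviation \<phi>T :: "real \<Rightarrow> 'a tangent" where
  "\<phi>T \<equiv> (\<lambda>t. \<phi> (C t) (velocity A C t))"

abbreviation \<theta> :: "real \<Rightarrow> real" where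
  "\<theta> t \<equiv> lee_form X A \<phi> g nabla \<xi> (C t)"

abbreviation dot :: "real \<Rightarrow> 'a tangent \<Rightarrow> 'a tangent \<Rightarrow> real" where
  "dot t \<equiv> g (C t)"

abbreviation TS :: "real \<Rightarrow> 'a tangent set" where
  "TS t \<equiv> tangent_space A (C t)"

lemma fields_smooth:
  shows "smooth_field_along A I C T" "smooth_field_along A I C (\<lambda>t. \<xi> (C t))"
    "smooth_field_along A I C \<phi>T"
  by (auto intro: velocity_smooth smooth_field_along_phi smooth_field_along_vector_field xi_smooth)

lemma fields_tangent:
  assumes "t \<in> I"
  shows "T t \<in> TS t" "\<xi> (C t) \<in> TS t" "\<phi>T t \<in> TS t"
  using fields_smooth smooth_field_along_tangent assms by blast+

lemma eta_T: "t \<in> I \<Longrightarrow> \<eta> (C t) (T t) = a"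
  using slant by (simp add: phi_slant_def)

lemma eta_\<phi>T: "t \<in> I \<Longrightarrow> \<eta> (C t) (\<phi>T t) = 0"
  by (simp add: eta_phi curve_in_topspace fields_tangent)

lemma T_nonzero: "t \<in> I \<Longrightarrow> T t \<noteq> 0"
  using null by (simp add: null_curve_def)

text \<open>The matrix of these nine products has determinant \<open>-(a^4 + b^2)\<close>, which
  explains the denominators in the formulas for the frame.\<close>

lemma gram:
  assumes t: "t \<in> I"
  shows "dot t (T t) (T t) = 0" "dot t (T t) (\<xi> (C t)) = a" "dot t (\<xi> (C t)) (T t) = a"
    "dot t (T t) (\<phi>T t) = b" "dot t (\<phi>T t) (T t) = b"
    "dot t (\<xi> (C t)) (\<xi> (C t)) = 1" "dot t (\<xi> (C t)) (\<phi>T t) = 0"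
    "dot t (\<phi>T t) (\<xi> (C t)) = 0" "dot t (\<phi>T t) (\<phi>T t) = a\<^sup>2"
proof -
  note p = curve_in_topspace[OF t] and f = fields_tangent[OF t]
  show TT: "dot t (T t) (T t) = 0" and Tf: "dot t (T t) (\<phi>T t) = b"
    using t null slant by (auto simp: null_curve_def phi_slant_def)
  then show "dot t (\<phi>T t) (T t) = b"
    using metric_sym[OF p f(3,1)] by simp
  show "dot t (T t) (\<xi> (C t)) = a" "dot t (\<xi> (C t)) (T t) = a" "dot t (\<xi> (C t)) (\<xi> (C t)) = 1"
    "dot t (\<xi> (C t)) (\<phi>T t) = 0" "dot t (\<phi>T t) (\<xi> (C t)) = 0"
    using p f t by (simp_all add: metric_xi metric_xi_left eta_T eta_\<phi>T eta_xi)
  show "dot t (\<phi>T t) (\<phi>T t) = a\<^sup>2"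
    using metric_phi_phi[OF p f(1,1)] t TT by (simp add: eta_T power2_eq_square)
qed

text \<open>Applying \<open>\<eta>\<close> gives \<open>y = - (x * a)\<close>, which leaves a
  relation in the kernel of \<open>\<eta>\<close>, where \<open>\<phi>\<close> squares to minus the
  identity. Combining it with its image under \<open>\<phi>\<close> yields
  \<open>(x * x + z * z) (T - a \<xi>) = 0\<close>. The vector \<open>T - a \<xi>\<close> is
  nonzero: otherwise \<open>g(T,T) = a * a\<close>, so \<open>a = 0\<close> and
  \<open>T = 0\<close>.\<close>

lemma slant_basis_independent:
  assumes t: "t \<in> I" and eq: "x *\<^sub>R T t + y *\<^sub>R \<xi> (C t) + z *\<^sub>R \<phi>T t = 0"
  shows "x = 0 \<and> y = 0 \<and> z = 0"
proof -
  note p = curve_in_topspace[OF t] and f = fields_tangent[OF t]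
  have "\<eta> (C t) (x *\<^sub>R T t + y *\<^sub>R \<xi> (C t) + z *\<^sub>R \<phi>T t) = 0"
    using eta_rules(5)[OF p f(1,1)] eq by simp
  then have y: "y = - (x * a)"
    using p f t by (simp add: eta_rules tangent_closed eta_T eta_\<phi>T eta_xi)
  have "\<phi> (C t) (x *\<^sub>R T t + y *\<^sub>R \<xi> (C t) + z *\<^sub>R \<phi>T t) = 0"
    using phi_rules(5)[OF p f(1,1)] eq by simp
  then have 2: "x *\<^sub>R \<phi>T t + (- z) *\<^sub>R T t + (z * a) *\<^sub>R \<xi> (C t) = 0"
    using p f t by (simp add: phi_rules tangent_closed phi_xi phi_phi eta_T algebra_simps)
  have "x *\<^sub>R (x *\<^sub>R T t + y *\<^sub>R \<xi> (C t) + z *\<^sub>R \<phi>T t)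
      - z *\<^sub>R (x *\<^sub>R \<phi>T t + (- z) *\<^sub>R T t + (z * a) *\<^sub>R \<xi> (C t)) = 0"
    using eq 2 by simp
  then have "(x * x + z * z) *\<^sub>R (T t - a *\<^sub>R \<xi> (C t)) = 0"
    by (simp add: y algebra_simps)
  moreover have "T t - a *\<^sub>R \<xi> (C t) \<noteq> 0"
  proof
    assume "T t - a *\<^sub>R \<xi> (C t) = 0"
    then have T: "T t = a *\<^sub>R \<xi> (C t)" by simp
    have "dot t (T t) (T t) = a * a"
      using metric_left(4)[OF p f(2,2,1), of a] gram[OF t] T by simp
    then have "a = 0"
      using gram[OF t] by simp
    then show False
      using T T_nonzero[OF t] by simp
  qed
  ultimately have "x * x + z * z = 0"
    by simp
  then show ?thesis
    using y by (simp add: sum_squares_eq_zero_iff)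
qed

lemma slant_basis_spans:
  assumes "t \<in> I" "v \<in> TS t"
  shows "\<exists>x y z. v = x *\<^sub>R T t + y *\<^sub>R \<xi> (C t) + z *\<^sub>R \<phi>T t"
  using tangent_spanned_by_three[OF curve_in_topspace[OF assms(1)] fields_tangent[OF assms(1)]
      slant_basis_independent[OF assms(1)] assms(2)] .

lemma slant_basis_detects:
  assumes t: "t \<in> I" and v: "v \<in> TS t"
    and "dot t v (T t) = 0" "dot t v (\<xi> (C t)) = 0" "dot t v (\<phi>T t) = 0"
  shows "v = 0"
proof (rule metric_nondegenerate[OF curve_in_topspace[OF t] v])
  fix w assume "w \<in> TS t"
  then obtain x y z where "w = x *\<^sub>R T t + y *\<^sub>R \<xi> (C t) + z *\<^sub>R \<phi>T t"
    using slant_basis_spans[OF t] by blast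
  then show "dot t v w = 0"
    using assms(3-) v fields_tangent[OF t] curve_in_topspace[OF t]
    by (simp add: metric_right tangent_closed)
qed

text \<open>If both constants vanished, \<open>T\<close> would be orthogonal to the whole slant
  basis, contradicting nondegeneracy.\<close>

lemma slant_constants_positive:
  assumes t: "t \<in> I"
  shows "a ^ 4 + b\<^sup>2 > 0"
proof -
  have "a \<noteq> 0 \<or> b \<noteq> 0"
    using slant_basis_detects[OF t fields_tangent(1)[OF t]] gram[OF t] T_nonzero[OF t] by auto
  moreover have "a ^ 4 \<ge> 0" "b\<^sup>2 \<ge> 0"
    by simp_all
  ultimately show ?thesis
    by (auto simp: add_pos_nonneg add_nonneg_pos zero_less_power_eq)
qed

lemma acceleration:
  assumes t: "t \<in> I"
  shows "dot t (D T t) (T t) = 0" "dot t (D T t) (\<xi> (C t)) = - \<theta> t * b / 2"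
    "dot t (D T t) (\<phi>T t) = \<theta> t * a ^ 3 / 2"
proof -
  note p = curve_in_topspace[OF t] and f = fields_tangent[OF t]
  note d = cov_deriv_along_tangent[OF t]
  have "dot t (D T t) (T t) + dot t (T t) (D T t) = 0"
    using gram by (intro cov_deriv_along_metric_const[OF fields_smooth(1,1) t]) auto
  then show "dot t (D T t) (T t) = 0"
    using metric_sym[OF p f(1) d[of T]] by simp
  have "dot t (D T t) (\<xi> (C t)) + dot t (T t) (D (\<lambda>s. \<xi> (C s)) t) = 0"
    using gram by (intro cov_deriv_along_metric_const[OF fields_smooth(1,2) t]) auto
  moreover have "dot t (T t) (D (\<lambda>s. \<xi> (C s)) t) = \<theta> t / 2 * b"
    using cov_deriv_along_xi[OF t f(1)] metric_sym[OF p f(1) d] gram[OF t] by simp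
  ultimately show "dot t (D T t) (\<xi> (C t)) = - \<theta> t * b / 2"
    by simp
  have "dot t (D T t) (\<phi>T t) + dot t (T t) (D \<phi>T t) = 0"
    using gram by (intro cov_deriv_along_metric_const[OF fields_smooth(1,3) t]) auto
  \<comment> \<open>Self-adjointness of \<open>\<phi>\<close> returns the unknown product, so it
    occurs twice in the differentiated equation; the two \<open>F4\<close> terms coincide because
    \<open>g(\<phi>T, \<phi>T) = a * a\<close>.\<close>
  moreover have "dot t (T t) (D \<phi>T t) = dot t (D T t) (\<phi>T t) - \<theta> t / 2 * (a\<^sup>2 * a + a\<^sup>2 * a)"
    using cov_deriv_along_phi[OF fields_smooth(1) t f(1)] metric_sym[OF p f(1) d]
      phi_self_adjoint[OF p d f(1)] gram[OF t] eta_T[OF t] by simp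
  ultimately show "dot t (D T t) (\<phi>T t) = \<theta> t * a ^ 3 / 2"
    by (simp add: algebra_simps power2_eq_square power3_eq_cube)
qed

section \<open>General Frenet frames along the curve\<close>

text \<open>The products within the frame are nondegenerate, so the three vectors form a basis. The
  null vectors \<open>T\<close> and \<open>N\<close> are dual to each other, which is why the
  coefficient of \<open>T\<close> is the product with \<open>N\<close> and vice versa.\<close>

lemma frenet_frame_expansion:
  assumes fr: "general_frenet_frame A g I C N W" and t: "t \<in> I" and v: "v \<in> TS t"
  shows "v = dot t v (N t) *\<^sub>R T t + dot t v (T t) *\<^sub>R N t + dot t v (W t) *\<^sub>R W t"
proof -
  note p = curve_in_topspace[OF t] and T = fields_tangent(1)[OF t]
  have N: "N t \<in> TS t" and W: "W t \<in> TS t"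
    using fr t smooth_field_along_tangent by (auto simp: general_frenet_frame_def)
  have pair: "dot t (T t) (N t) = 1" "dot t (W t) (W t) = 1" "dot t (N t) (N t) = 0"
    "dot t (N t) (W t) = 0" "dot t (T t) (W t) = 0"
    using fr t by (auto simp: general_frenet_frame_def)
  have pair': "dot t (N t) (T t) = 1" "dot t (W t) (N t) = 0" "dot t (W t) (T t) = 0"
    using pair metric_sym[OF p] T N W by auto
  note pairs = pair pair' gram(1)[OF t]
  have indep: "x = 0 \<and> y = 0 \<and> z = 0" if eq: "x *\<^sub>R T t + y *\<^sub>R N t + z *\<^sub>R W t = 0" for x y z
  proof -
    have "dot t (x *\<^sub>R T t + y *\<^sub>R N t + z *\<^sub>R W t) u = 0" if "u \<in> TS t" for u
      using metric_left(5)[OF p T T that] eq by simp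
    from this[OF T] this[OF N] this[OF W] show ?thesis
      using p T N W by (simp add: metric_left tangent_closed pairs)
  qed
  obtain x y z where v: "v = x *\<^sub>R T t + y *\<^sub>R N t + z *\<^sub>R W t"
    using tangent_spanned_by_three[OF p T N W indep v] by blast
  have "dot t v (N t) = x" "dot t v (T t) = y" "dot t v (W t) = z"
    unfolding v using p T N W by (simp_all add: metric_left tangent_closed pairs)
  then show ?thesis
    using v by simp
qed

text \<open>Nine products of derivatives with frame vectors occur. The null and unit conditions kill
  those of \<open>D T\<close>, \<open>D N\<close>, \<open>D W\<close> with \<open>T\<close>,
  \<open>N\<close>, \<open>W\<close> respectively, and the mixed conditions pair the other six up to
  sign, leaving three functions.\<close>

lemma frenet_equations_exist:
  assumes fr: "general_frenet_frame A g I C N W"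
  shows "frenet_equations A nabla I C N W (\<lambda>t. dot t (D T t) (N t)) (\<lambda>t. dot t (D T t) (W t))
    (\<lambda>t. dot t (D N t) (W t))"
  unfolding frenet_equations_def
proof (intro ballI conjI)
  fix t assume t: "t \<in> I"
  note p = curve_in_topspace[OF t] and d = cov_deriv_along_tangent[OF t]
  have Ns: "smooth_field_along A I C N" and Ws: "smooth_field_along A I C W"
    using fr by (auto simp: general_frenet_frame_def)
  note s = fields_smooth(1) Ns Ws
  note m = s[THEN smooth_field_along_tangent[OF _ t]]
  have pair: "dot s (T s) (N s) = 1" "dot s (W s) (W s) = 1" "dot s (N s) (N s) = 0"
    "dot s (N s) (W s) = 0" "dot s (T s) (W s) = 0" if "s \<in> I" for s
    using fr that by (auto simp: general_frenet_frame_def)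
  have NN: "dot t (D N t) (N t) = 0"
    using cov_deriv_along_metric_const[OF Ns Ns t pair(3)] metric_sym[OF p m(2) d[of N]] by simp
  have WW: "dot t (D W t) (W t) = 0"
    using cov_deriv_along_metric_const[OF Ws Ws t pair(2)] metric_sym[OF p m(3) d[of W]] by simp
  have NT: "dot t (D N t) (T t) = - dot t (D T t) (N t)"
    using cov_deriv_along_metric_const[OF s(1) Ns t pair(1)] metric_sym[OF p m(1) d[of N]] by simp
  have WT: "dot t (D W t) (T t) = - dot t (D T t) (W t)"
    using cov_deriv_along_metric_const[OF s(1) Ws t pair(5)] metric_sym[OF p m(1) d[of W]] by simp
  have WN: "dot t (D W t) (N t) = - dot t (D N t) (W t)"
    using cov_deriv_along_metric_const[OF Ns Ws t pair(4)] metric_sym[OF p m(2) d[of W]] by simp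
  show "D T t = dot t (D T t) (N t) *\<^sub>R T t + dot t (D T t) (W t) *\<^sub>R W t"
    using frenet_frame_expansion[OF fr t d[of T]] acceleration(1)[OF t] by simp
  show "D N t = - dot t (D T t) (N t) *\<^sub>R N t + dot t (D N t) (W t) *\<^sub>R W t"
    using frenet_frame_expansion[OF fr t d[of N]] by (simp add: NN NT)
  show "D W t = - dot t (D N t) (W t) *\<^sub>R T t - dot t (D T t) (W t) *\<^sub>R N t"
    using frenet_frame_expansion[OF fr t d[of W]] by (simp add: WW WT WN)
qed

section \<open>Constant-coefficient fields in the slant basis\<close>

text \<open>The frame of the theorem has constant coefficients in the slant basis. Naming such
  fields by their coefficients reduces metric and derivative computations to formulas in
  \<open>a\<close>, \<open>b\<close> and \<open>\<theta>\<close>.\<close>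

definition combo :: "real \<Rightarrow> real \<Rightarrow> real \<Rightarrow> real \<Rightarrow> 'a tangent" where
  "combo x y z t = x *\<^sub>R T t + y *\<^sub>R \<xi> (C t) + z *\<^sub>R \<phi>T t"

lemma combo_smooth: "smooth_field_along A I C (combo x y z)"
  unfolding combo_def[abs_def]
  by (intro smooth_field_along_add smooth_field_along_scale fields_smooth)

lemma combo_tangent: "t \<in> I \<Longrightarrow> combo x y z t \<in> TS t"
  using combo_smooth by (rule smooth_field_along_tangent)

lemma combo_eq_iff:
  assumes "t \<in> I"
  shows "combo x y z t = combo x' y' z' t \<longleftrightarrow> x = x' \<and> y = y' \<and> z = z'"
  using slant_basis_independent[OF assms, of "x - x'" "y - y'" "z - z'"]
  by (auto simp: combo_def algebra_simps)

lemma combo_basis: "combo 1 0 0 t = T t"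
  by (simp add: combo_def)

lemma dot_combo:
  assumes "t \<in> I"
  shows "dot t (combo x y z t) (combo x' y' z' t) =
    a * (x * y' + x' * y) + b * (x * z' + x' * z) + y * y' + a\<^sup>2 * z * z'"
  unfolding combo_def using fields_tangent[OF assms] curve_in_topspace[OF assms]
  by (simp add: metric_left metric_right tangent_closed gram[OF assms] algebra_simps)

lemma dot_right_combo:
  assumes "t \<in> I" "v \<in> TS t"
  shows "dot t v (combo x y z t) = x * dot t v (T t) + y * dot t v (\<xi> (C t)) + z * dot t v (\<phi>T t)"
  unfolding combo_def using fields_tangent[OF assms(1)] curve_in_topspace[OF assms(1)] assms(2)
  by (simp add: metric_right tangent_closed)

lemma dot_acceleration_combo:
  assumes "t \<in> I"
  shows "dot t (D T t) (combo x y z t) = \<theta> t / 2 * (a ^ 3 * z - b * y)"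
  using assms by (simp add: dot_right_combo cov_deriv_along_tangent acceleration algebra_simps)

lemma eta_combo: "t \<in> I \<Longrightarrow> \<eta> (C t) (combo x y z t) = a * x + y"
  unfolding combo_def using fields_tangent[of t] curve_in_topspace[of t]
  by (simp add: eta_rules tangent_closed eta_T eta_\<phi>T eta_xi)

lemma phi_combo: "t \<in> I \<Longrightarrow> \<phi> (C t) (combo x y z t) = combo (- z) (a * z) x t"
  unfolding combo_def using fields_tangent[of t] curve_in_topspace[of t]
  by (simp add: phi_rules tangent_closed phi_phi phi_xi eta_T algebra_simps)

lemma cov_deriv_combo:
  assumes "t \<in> I"
  shows "D (combo x y z) t = x *\<^sub>R D T t + y *\<^sub>R D (\<lambda>s. \<xi> (C s)) t + z *\<^sub>R D \<phi>T t"
  unfolding combo_def[abs_def] using assms fields_smooth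
  by (simp add: cov_deriv_along_add cov_deriv_along_scale smooth_field_along_add
      smooth_field_along_scale)

text \<open>The coefficient of \<open>T\<close> is zero because the lemma serves \<open>W1\<close>.
  The \<open>\<xi>\<close> part comes from \<open>cov_deriv_along_xi\<close>; in the
  \<open>\<phi>T\<close> part self-adjointness moves \<open>\<phi>\<close> onto the second field,
  which leaves products with the known acceleration.\<close>

lemma dot_cov_deriv_combo:
  assumes t: "t \<in> I"
  shows "dot t (D (combo 0 y z) t) (combo x' y' z' t) = \<theta> t / 2 *
    (y * (b * x' + a\<^sup>2 * z') + z * (a ^ 3 * x' - a * b * z' - a\<^sup>2 * (a * x' + y')
      - a * (- (a * y' + b * z') + a * (a * x' + y'))))"
proof -
  note p = curve_in_topspace[OF t] and d = cov_deriv_along_tangent[OF t]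
    and v = combo_tangent[OF t, of x' y' z'] and f = fields_tangent[OF t]
  let ?v = "combo x' y' z' t"
  have Tv: "dot t (T t) ?v = a * y' + b * z'" and fTv: "dot t (\<phi>T t) ?v = b * x' + a\<^sup>2 * z'"
    using t f by (simp_all add: dot_right_combo gram)
  have 1: "dot t (D (\<lambda>s. \<xi> (C s)) t) ?v = \<theta> t / 2 * (b * x' + a\<^sup>2 * z')"
    using cov_deriv_along_xi[OF t v] fTv by simp
  have "dot t (\<phi> (C t) (D T t)) ?v = dot t (D T t) (combo (- z') (a * z') x' t)"
    using phi_self_adjoint[OF p d v] t by (simp add: phi_combo)
  also have "\<dots> = \<theta> t / 2 * (a ^ 3 * x' - a * b * z')"
    using t by (simp add: dot_acceleration_combo algebra_simps)
  finally have 2: "dot t (D \<phi>T t) ?v = \<theta> t / 2 * (a ^ 3 * x' - a * b * z') - \<theta> t / 2 *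
      (a\<^sup>2 * (a * x' + y') + (- (a * y' + b * z') + a * (a * x' + y')) * a)"
    using cov_deriv_along_phi[OF fields_smooth(1) t v] metric_phi_phi[OF p f(1) v] Tv t
    by (simp add: gram eta_T eta_combo)
  have "dot t (D (combo 0 y z) t) ?v =
      y * dot t (D (\<lambda>s. \<xi> (C s)) t) ?v + z * dot t (D \<phi>T t) ?v"
    using d v p by (simp add: cov_deriv_combo[OF t] metric_left tangent_closed)
  then show ?thesis
    unfolding 1 2 by (simp add: field_simps)
qed

section \<open>The distinguished frame and its second curvature\<close>

abbreviation \<sigma> :: real where
  "\<sigma> \<equiv> a ^ 4 + b\<^sup>2"

text \<open>The vector \<open>-b \<xi> + a \<phi>T\<close> has products \<open>0\<close>,
  \<open>-b\<close>, \<open>a^3\<close> with \<open>T\<close>, \<open>\<xi>\<close>,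
  \<open>\<phi>T\<close>, proportional to those of the acceleration. Its squared length
  \<open>b^2 + a^2 * a^2\<close> is \<open>\<sigma>\<close>.\<close>

definition W1 :: "real \<Rightarrow> 'a tangent" where
  "W1 = combo 0 (- (b / sqrt \<sigma>)) (a / sqrt \<sigma>)"

text \<open>Orthogonality to \<open>W1\<close> reads \<open>a^3 z = b y\<close>, so
  \<open>(y, z)\<close> is proportional to \<open>(a^3, b)\<close>. The condition
  \<open>a y + b z = 1\<close> fixes the factor \<open>1 / \<sigma>\<close>, and nullity then fixes
  \<open>x\<close>.\<close>

definition N1 :: "real \<Rightarrow> 'a tangent" where
  "N1 = combo (- (a\<^sup>2 / (2 * \<sigma>))) (a ^ 3 / \<sigma>) (b / \<sigma>)"

lemma sqrt_sigma:
  assumes "t \<in> I"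
  shows "sqrt \<sigma> > 0" "\<sigma> = sqrt \<sigma> * sqrt \<sigma>"
  using slant_constants_positive[OF assms] by simp_all

lemma frame_F1: "general_frenet_frame A g I C N1 W1"
  unfolding general_frenet_frame_def
proof (intro conjI ballI)
  show "smooth_field_along A I C N1" "smooth_field_along A I C W1"
    by (simp_all add: N1_def W1_def combo_smooth)
  fix t assume t: "t \<in> I"
  define s where "s = sqrt \<sigma>"
  have s: "s > 0" "\<sigma> = s * s" and \<sigma>: "\<sigma> > 0"
    using sqrt_sigma[OF t] slant_constants_positive[OF t] by (auto simp: s_def)
  have T: "T t = combo 1 0 0 t"
    by (simp add: combo_basis)
  show "dot t (T t) (N1 t) = 1"
    using \<sigma> unfolding T N1_def dot_combo[OF t]
    by (simp add: add_divide_distrib[symmetric] power_numeral_reduce)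
  show "dot t (T t) (W1 t) = 0"
    unfolding T W1_def dot_combo[OF t] by simp
  have "dot t (W1 t) (W1 t) = \<sigma> / (s * s)"
    unfolding W1_def dot_combo[OF t] s_def[symmetric]
    by (simp add: add_divide_distrib power_numeral_reduce)
  then show "dot t (W1 t) (W1 t) = 1"
    using s by simp
  show "dot t (N1 t) (W1 t) = 0"
    unfolding N1_def W1_def dot_combo[OF t] by (simp add: power_numeral_reduce)
  \<comment> \<open>The first term collects the squares from \<open>\<xi>\<close> and
    \<open>\<phi>T\<close>; the second is twice the \<open>T\<close> coefficient times
    \<open>g(T, N1)\<close>, with that product kept as \<open>\<sigma> / \<sigma>\<close>.\<close>
  have "dot t (N1 t) (N1 t) = a\<^sup>2 * \<sigma> / (\<sigma> * \<sigma>) - a\<^sup>2 / \<sigma> * (\<sigma> / \<sigma>)"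
    unfolding N1_def dot_combo[OF t] using \<sigma>
    by (simp add: divide_simps) (simp add: power_numeral_reduce algebra_simps)
  then show "dot t (N1 t) (N1 t) = 0"
    using \<sigma> by simp
qed

lemma acceleration_F1:
  assumes t: "t \<in> I"
  shows "dot t (D T t) (N1 t) = 0" "dot t (D T t) (W1 t) = \<theta> t * sqrt \<sigma> / 2"
proof -
  show "dot t (D T t) (N1 t) = 0"
    unfolding N1_def dot_acceleration_combo[OF t] by simp
  have "dot t (D T t) (W1 t) = \<theta> t / 2 * (\<sigma> / sqrt \<sigma>)"
    unfolding W1_def dot_acceleration_combo[OF t]
    by (simp add: add_divide_distrib power_numeral_reduce)
  then show "dot t (D T t) (W1 t) = \<theta> t * sqrt \<sigma> / 2"
    using slant_constants_positive[OF t] by (simp add: real_div_sqrt)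
qed

lemma acceleration_along_W1:
  assumes "t \<in> I"
  shows "D T t = (\<theta> t * sqrt \<sigma> / 2) *\<^sub>R W1 t"
  using frenet_frame_expansion[OF frame_F1 assms cov_deriv_along_tangent[OF assms, of T],
      unfolded acceleration(1)[OF assms] acceleration_F1[OF assms]] by simp

text \<open>The value is read off the equation for \<open>D W1\<close>, not the one for
  \<open>D N1\<close>: \<open>W1\<close> has no \<open>T\<close> component, so its derivative
  involves only those of \<open>\<xi>\<close> and \<open>\<phi>T\<close>.\<close>

lemma curvature_F1:
  assumes eqs: "frenet_equations A nabla I C N1 W1 h k1 k2" and t: "t \<in> I"
  shows "k2 t = a\<^sup>2 * \<theta> t / (4 * sqrt \<sigma>)"
proof -
  note p = curve_in_topspace[OF t] and T = fields_tangent(1)[OF t]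
  define s where "s = sqrt \<sigma>"
  have s: "s > 0" "\<sigma> = s * s" and \<sigma>: "\<sigma> > 0"
    using sqrt_sigma[OF t] slant_constants_positive[OF t] by (auto simp: s_def)
  have N: "N1 t \<in> TS t"
    by (simp add: N1_def combo_tangent t)
  have "D W1 t = - k2 t *\<^sub>R T t - k1 t *\<^sub>R N1 t"
    using eqs t by (simp add: frenet_equations_def)
  then have "dot t (D W1 t) (N1 t) = - k2 t"
    using frame_F1 t p T N by (simp add: metric_left tangent_closed general_frenet_frame_def)
  \<comment> \<open>The numerators add up to a multiple of \<open>\<sigma>\<close>. Keeping
    \<open>\<sigma> / \<sigma>\<close> uncancelled leaves a polynomial identity once the
    denominators are cleared.\<close>
  moreover have "dot t (D W1 t) (N1 t) = - (a\<^sup>2 * \<theta> t / (4 * s)) * (\<sigma> / \<sigma>)"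
    unfolding W1_def N1_def dot_cov_deriv_combo[OF t] s_def[symmetric] using \<sigma> s(1)
    by (simp add: divide_simps) (simp add: power_numeral_reduce algebra_simps)
  ultimately show ?thesis
    using \<sigma> by (simp add: s_def)
qed

lemma distinguished_F1: "distinguished_parameter A nabla I C N1 W1"
  unfolding distinguished_parameter_def
  using frenet_equations_exist[OF frame_F1] acceleration_F1(1) by blast

section \<open>Orientation and uniqueness of the frame\<close>

text \<open>Independence makes the change-of-basis matrix unique. Both bases start with
  \<open>T\<close>, so its first row is \<open>(1, 0, 0)\<close> and its determinant is the
  remaining 2-by-2 minor.\<close>

lemma same_orientation_slant_basis:
  assumes t: "t \<in> I"
  shows "same_orientation (vector [T t, combo x y z t, combo x' y' z' t])
      (vector [T t, \<xi> (C t), \<phi>T t]) \<longleftrightarrow> y * z' - z * y' > 0"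
proof -
  have combo: "(\<Sum>j\<in>UNIV. P $ i $ j *\<^sub>R (vector [T t, \<xi> (C t), \<phi>T t] :: 'a tangent^3) $ j) =
      combo (P $ i $ 1) (P $ i $ 2) (P $ i $ 3) t" for P :: "real^3^3" and i
    by (simp add: sum_3 combo_def)
  show ?thesis
  proof
    assume "same_orientation (vector [T t, combo x y z t, combo x' y' z' t])
      (vector [T t, \<xi> (C t), \<phi>T t])"
    then obtain P :: "real^3^3" where P: "det P > 0"
      "combo 1 0 0 t = combo (P $ 1 $ 1) (P $ 1 $ 2) (P $ 1 $ 3) t"
      "combo x y z t = combo (P $ 2 $ 1) (P $ 2 $ 2) (P $ 2 $ 3) t"
      "combo x' y' z' t = combo (P $ 3 $ 1) (P $ 3 $ 2) (P $ 3 $ 3) t"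
      unfolding same_orientation_def combo by (auto simp: forall_3 combo_basis)
    show "y * z' - z * y' > 0"
      using P(1) P(2-)[unfolded combo_eq_iff[OF t]] by (simp add: det_3)
  next
    assume pos: "y * z' - z * y' > 0"
    define P :: "real^3^3" where "P = vector [vector [1, 0, 0], vector [x, y, z], vector [x', y', z']]"
    have "det P > 0"
      using pos by (simp add: det_3 P_def)
    then show "same_orientation (vector [T t, combo x y z t, combo x' y' z' t])
      (vector [T t, \<xi> (C t), \<phi>T t])"
      unfolding same_orientation_def combo
      by (intro exI[of _ P]) (simp add: forall_3 combo_basis P_def)
  qed
qed

lemma oriented_F1:
  assumes t: "t \<in> I"
  shows "same_orientation (vector [T t, N1 t, W1 t]) (vector [T t, \<xi> (C t), \<phi>T t])"
proof -
  have "a ^ 3 / \<sigma> * (a / sqrt \<sigma>) - b / \<sigma> * (- (b / sqrt \<sigma>)) = \<sigma> / (\<sigma> * sqrt \<sigma>)"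
    by (simp add: add_divide_distrib power_numeral_reduce)
  also have "\<dots> > 0"
    using slant_constants_positive[OF t] by simp
  finally show ?thesis
    unfolding N1_def W1_def same_orientation_slant_basis[OF t] .
qed

text \<open>Uniqueness rests on this: where \<open>\<theta>\<close> vanished the acceleration would
  be zero and \<open>h = 0\<close> would hold there for every frame. Pairing the first Frenet
  equation with \<open>W\<close> shows that \<open>k1\<close> would vanish too.\<close>

lemma lee_form_nonzero:
  assumes "non_geodesic A g nabla I C" and t: "t \<in> I"
  shows "\<theta> t \<noteq> 0"
proof
  assume "\<theta> t = 0"
  then have D0: "D T t = 0"
    using acceleration_along_W1[OF t] by simp
  obtain N W h k1 k2 where fr: "general_frenet_frame A g I C N W"
    and eqs: "frenet_equations A nabla I C N W h k1 k2" and k1: "k1 t \<noteq> 0"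
    using assms unfolding non_geodesic_def by blast
  note p = curve_in_topspace[OF t] and T = fields_tangent(1)[OF t]
  have W: "W t \<in> TS t"
    using fr t smooth_field_along_tangent by (auto simp: general_frenet_frame_def)
  have "dot t (h t *\<^sub>R T t + k1 t *\<^sub>R W t) (W t) = dot t (D T t) (W t)"
    using eqs t by (simp add: frenet_equations_def)
  then show False
    using fr t p T W k1 D0 by (simp add: metric_left tangent_closed general_frenet_frame_def)
qed

lemma frame_F1_unique:
  assumes "non_geodesic A g nabla I C" and fr: "general_frenet_frame A g I C N W"
    and orient: "same_orientation (vector [T t, N t, W t]) (vector [T t, \<xi> (C t), \<phi>T t])"
    and dist: "distinguished_parameter A nabla I C N W" and t: "t \<in> I"
  shows "N t = N1 t \<and> W t = W1 t"
proof -
  note p = curve_in_topspace[OF t] and T = fields_tangent(1)[OF t]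
  have N: "N t \<in> TS t" and W: "W t \<in> TS t"
    using fr t smooth_field_along_tangent by (auto simp: general_frenet_frame_def)
  have N1: "N1 t \<in> TS t" and W1: "W1 t \<in> TS t"
    by (simp_all add: N1_def W1_def combo_tangent t)
  \<comment> \<open>The acceleration is a multiple of \<open>W1\<close> with factor \<open>k\<close>
    and a multiple of \<open>W\<close> with factor \<open>k'\<close>. As \<open>k\<close> is
    nonzero, \<open>W1\<close> is a multiple of \<open>W\<close>, and the unit lengths make the
    ratio \<open>1\<close> or \<open>-1\<close>.\<close>
  define k where "k = \<theta> t * sqrt \<sigma> / 2"
  have k: "k \<noteq> 0"
    using lee_form_nonzero[OF assms(1) t] sqrt_sigma(1)[OF t] by (simp add: k_def)
  obtain h k1 k2 where "frenet_equations A nabla I C N W h k1 k2" "h t = 0"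
    using dist t unfolding distinguished_parameter_def by blast
  then obtain k' where "D T t = k' *\<^sub>R W t"
    using that[of "k1 t"] t by (simp add: frenet_equations_def)
  then have "k *\<^sub>R W1 t = k' *\<^sub>R W t"
    using acceleration_along_W1[OF t] by (simp add: k_def)
  then have W1_eq: "W1 t = (k' / k) *\<^sub>R W t"
    using k by (metis divide_inverse_commute scaleR_one scaleR_scaleR left_inverse)
  define r where "r = k' / k"
  have r: "W1 t = r *\<^sub>R W t"
    using W1_eq by (simp add: r_def)
  have "dot t (W1 t) (W1 t) = r * (r * dot t (W t) (W t))"
    unfolding r using p W by (simp add: metric_left metric_right tangent_closed)
  then have rr: "r * r = 1"
    using fr frame_F1 t by (simp add: general_frenet_frame_def)
  then have W_eq: "W t = r *\<^sub>R W1 t"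
    by (simp add: r)
  have "dot t (N t) (W1 t) = 0"
    unfolding r using fr t p N W by (simp add: metric_right general_frenet_frame_def)
  moreover have "dot t (N t) (T t) = 1"
    using fr t metric_sym[OF p N T] by (simp add: general_frenet_frame_def)
  \<comment> \<open>Whatever the sign, \<open>N\<close> is orthogonal to \<open>W1\<close> and has
    product 1 with \<open>T\<close>, so \<open>N\<close> and \<open>N1\<close> differ by a multiple
    of \<open>T\<close>. Nullity of both then eliminates that multiple.\<close>
  ultimately have N_eq: "N t = dot t (N t) (N1 t) *\<^sub>R T t + N1 t"
    using frenet_frame_expansion[OF frame_F1 t N] by simp
  define x where "x = dot t (N t) (N1 t)"
  have "dot t (N t) (N t) = dot t (x *\<^sub>R T t + N1 t) (x *\<^sub>R T t + N1 t)"
    using N_eq by (simp add: x_def)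
  also have "\<dots> = 2 * x"
    using frame_F1 t p T N1 metric_sym[OF p N1 T]
    by (simp add: metric_left metric_right tangent_closed gram(1) general_frenet_frame_def)
  finally have "x = 0"
    using fr t by (simp add: general_frenet_frame_def)
  then have N_N1: "N t = N1 t"
    using N_eq by (simp add: x_def)
  \<comment> \<open>With \<open>N\<close> identified, the orientation determinant of the frame is
    \<open>r / sqrt \<sigma>\<close>, so its positivity selects \<open>r = 1\<close>.\<close>
  have "W t = combo 0 (- (r * b / sqrt \<sigma>)) (r * a / sqrt \<sigma>) t"
    unfolding W_eq W1_def combo_def by (simp add: algebra_simps)
  then have "a ^ 3 / \<sigma> * (r * a / sqrt \<sigma>) - b / \<sigma> * (- (r * b / sqrt \<sigma>)) > 0"
    using orient unfolding N_N1 N1_def by (simp only: same_orientation_slant_basis[OF t])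
  moreover have "a ^ 3 / \<sigma> * (r * a / sqrt \<sigma>) - b / \<sigma> * (- (r * b / sqrt \<sigma>)) =
      r * (\<sigma> / (\<sigma> * sqrt \<sigma>))"
    by (simp add: add_divide_distrib power_numeral_reduce distrib_left algebra_simps)
  ultimately have "r > 0"
    using slant_constants_positive[OF t] by (simp add: zero_less_mult_iff zero_less_divide_iff)
  moreover have "r = 1 \<or> r = -1"
    using rr by (simp add: square_eq_1_iff)
  ultimately have "r = 1"
    by auto
  then show ?thesis
    using N_N1 W_eq by simp
qed

end

theorem theorem3p7:
  fixes X :: "'a topology" and A :: "'a chart set"
    and \<phi> :: "'a \<Rightarrow> 'a tangent \<Rightarrow> 'a tangent" and \<xi> :: "'a \<Rightarrow> 'a tangent"
    and \<eta> :: "'a \<Rightarrow> 'a tangent \<Rightarrow> real" and g :: "'a \<Rightarrow> 'a tangent \<Rightarrow> 'a tangent \<Rightarrow> real"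
    and nabla :: "'a conn" and I :: "real set" and C :: "real \<Rightarrow> 'a" and a b :: real
  defines "\<theta>\<xi> \<equiv> lee_form X A \<phi> g nabla \<xi>"
    and "T \<equiv> velocity A C"
    and "\<phi>T \<equiv> (\<lambda>t. \<phi> (C t) (velocity A C t))"
  defines "oriented \<equiv> (\<lambda>N W. \<forall>t\<in>I.
      same_orientation (vector [T t, N t, W t]) (vector [T t, \<xi> (C t), \<phi>T t]))"
  assumes "F4_manifold X A \<phi> \<xi> \<eta> g nabla"
    and "smooth_curve X A I C"
    and "null_curve A g I C"
    and "phi_slant A \<phi> \<eta> g I C a b"
    and "non_geodesic A g nabla I C"
  shows "\<exists>N1 W1.
      general_frenet_frame A g I C N1 W1 \<and> oriented N1 W1 \<and>
      distinguished_parameter A nabla I C N1 W1 \<and>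
      (\<forall>N W. general_frenet_frame A g I C N W \<and> oriented N W \<and>
         distinguished_parameter A nabla I C N W \<longrightarrow> (\<forall>t\<in>I. N t = N1 t \<and> W t = W1 t)) \<and>
      (\<forall>t\<in>I. W1 t = - (b / sqrt (a^4 + b^2)) *\<^sub>R \<xi> (C t) + (a / sqrt (a^4 + b^2)) *\<^sub>R \<phi>T t) \<and>
      (\<forall>t\<in>I. N1 t = (a^3 / (a^4 + b^2)) *\<^sub>R \<xi> (C t)
                    - (a^2 / (2 * (a^4 + b^2))) *\<^sub>R T t + (b / (a^4 + b^2)) *\<^sub>R \<phi>T t) \<and>
      (\<forall>h k1 k2. frenet_equations A nabla I C N1 W1 h k1 k2 \<longrightarrow>
         (\<forall>t\<in>I. k2 t = a^2 * \<theta>\<xi> (C t) / (4 * sqrt (a^4 + b^2))))"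
proof -
  have mfd: "smooth_manifold X A" and conn: "affine_connection X A nabla"
    using assms(5) unfolding F4_manifold_def almost_contact_B_metric_manifold_def levi_civita_def
    by blast+
  interpret K: slant_null_curve X A I C nabla \<phi> \<xi> \<eta> g a b
    by unfold_locales (use mfd conn assms(5-8) in auto)
  show ?thesis
    unfolding oriented_def T_def \<phi>T_def \<theta>\<xi>_def
  proof (rule exI[of _ K.N1], rule exI[of _ K.W1], intro conjI ballI allI impI)
    fix N W t
    assume "general_frenet_frame A g I C N W \<and>
        (\<forall>t\<in>I. same_orientation (vector [velocity A C t, N t, W t])
          (vector [velocity A C t, \<xi> (C t), \<phi> (C t) (velocity A C t)])) \<and>
        distinguished_parameter A nabla I C N W" "t \<in> I"
    then have "N t = K.N1 t \<and> W t = K.W1 t"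
      using assms(9) by (intro K.frame_F1_unique) auto
    then show "N t = K.N1 t" "W t = K.W1 t"
      by auto
  next
    fix t
    show "K.W1 t = - (b / sqrt (a^4 + b^2)) *\<^sub>R \<xi> (C t) +
        (a / sqrt (a^4 + b^2)) *\<^sub>R \<phi> (C t) (velocity A C t)"
      by (simp add: K.W1_def K.combo_def)
    show "K.N1 t = (a^3 / (a^4 + b^2)) *\<^sub>R \<xi> (C t) - (a^2 / (2 * (a^4 + b^2))) *\<^sub>R velocity A C t +
        (b / (a^4 + b^2)) *\<^sub>R \<phi> (C t) (velocity A C t)"
      by (simp add: K.N1_def K.combo_def)
  qed (fact K.frame_F1 K.distinguished_F1 | erule K.oriented_F1 | erule (1) K.curvature_F1)+
qed

end
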